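(* Let $\{x^t\}$ be generated by algorithm AEPG (described in the context) under the standing assumptions, the Kurdyka–Łojasiewicz (KL) assumption with exponent $\tilde\sigma\in[0,1)$, and the assumption on $t_\star$, all stated in the context. There exists $t'$ such that for all $t\ge t'$, we have: (a) If $\tilde\sigma=0$, then the sequence $x^t$ converges in a finite number of steps. (b) If $\tilde\sigma\in(0,\frac12]$, then there exists $\dot\varsigma\in(0,1)$ such that $\|x^t-x^\infty\|=\mathcal O(\dot\varsigma^{\,t})$. (c) If $\tilde\sigma\in(\frac12,1)$, then $\|x^t-x^\infty\|\le\mathcal O(t^{-\dot\varsigma})$, where $\dot\varsigma\triangleq\frac{1-\tilde\sigma}{2\tilde\sigma-1}>0$.
   Context: Problem: minimize $F(x)=f(x)+h(x)$ over $x\in\mathbb R^n$, where $f=\frac1N\sum_{i=1}^N f_i$ is differentiable (possibly nonconvex), and $h$ is proper and lower semicontinuous (possibly nonconvex, nonsmooth and non-Lipschitz). Notation: vector operations ($\odot$ product, $\div$ division, square root) are componentwise; $\mathbf 1$ is the all-ones vector; $\min(v)$ is the smallest entry of a vector $v$; a vector plus a scalar adds the scalar to each entry; $\|x\|=\|x\|_2$; $\|x\|_v^2=\sum_i x_i^2v_i$; $\partial$ is the limiting subdifferential; $\mathrm{dist}(0,\cdot)$ is the Euclidean distance from the origin to a set. Standing assumptions: (1) the generalized proximal operator $\mathrm{Prox}_h(a;v)\triangleq\arg\min_x h(x)+\frac12\|x-a\|_v^2$ can be computed exactly and efficiently for all $a,v\in\mathbb R^n$; (2) there is a constant $\overline{\mathrm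 x}>0$ with $\|x\|\le\overline{\mathrm x}$ for all $x\in\mathrm{dom}(F)$, and $\min_xF(x)>-\infty$; (3) each $f_j$ is $L$-smooth: $\|\nabla f_j(x)-\nabla f_j(\tilde x)\|\le L\|x-\tilde x\|$ for all $x,\tilde x$ (hence so is $f$). Let $\bar x\in\arg\min_x F(x)$. Algorithm AEPG: parameters $\underline{\mathrm v}>0$, $\alpha>0$, $\beta\ge0$, $\theta\in[0,1)$; initial point $x^0$, $x^{-1}=x^0$, $v^0=\underline{\mathrm v}\mathbf 1$, $y^0=x^0$, $\sigma^{-1}=\theta$. For $t=0,1,2,\dots$: $g^t=\nabla f(y^t)$; $x^{t+1}\in\mathrm{Prox}_h(y^t-g^t\div v^t;v^t)$; $d^t=x^{t+1}-x^t$; $r^t=v^t\odot d^t$; $s^t=\alpha\|r^t\|_2^2\mathbf 1+\beta\, r^t\odot r^t$; $v^{t+1}=\sqrt{v^0\odot v^0+\sum_{i=0}^t s^i}$; $\sigma^t=\theta(1-\sigma^{t-1})\min(v^t\div v^{t+1})$; $y^{t+1}=x^{t+1}+\sigma^t d^t$. KL assumption: the function $\mathcal Z(x,x',\sigma,v)\triangleq F(x)-F(\bar x)+\frac12\|x-x'\|^2_{\sigma(v+L)}$ is a KL function with respect to $\mathbb W=(x,x',\sigma,v)$. Put $\mathbb W^t=(x^t,x^{t-1},\sigma^{t-1},v^t)$; the superscript $\infty$ (in $x^\infty$, $\mathbb W^\infty$) denotes the limit as $t\to\infty$. The KL property gives $\tilde\eta\in(0,+\infty)$, $\tilde\sigma\in[0,1)$,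 a neighborhood $\Upsilon$ of $\mathbb W^\infty$, and a continuous concave desingularization function $\varphi(s)=\tilde c\,s^{1-\tilde\sigma}$ with $\tilde c>0$, $s\in[0,\tilde\eta)$, such that $\varphi'(\mathcal Z(\mathbb W)-\mathcal Z(\mathbb W^\infty))\cdot\mathrm{dist}(0,\partial\mathcal Z(\mathbb W))\ge1$ for all $\mathbb W\in\Upsilon$ with $\mathcal Z(\mathbb W)-\mathcal Z(\mathbb W^\infty)\in(0,\tilde\eta)$. The number $\tilde\sigma$ is the exponent in the claim. Assumption on $t_\star$: there exists a sufficiently large index $t_\star$ such that $\xi\triangleq c_1\min(v^{t_\star})-c_2>0$, where $c_1=\frac12\big(\frac{1-\theta}{\kappa}\big)^2$, $c_2=\frac{3L}2$, $\kappa=1+\sqrt{\beta/\alpha}$. *)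

theory Defs
  imports "HOL-Analysis.Analysis"
begin

definition edom :: "('a \<Rightarrow> ereal) \<Rightarrow> 'a set" where
  "edom F = {x. F x < \<infinity>}"

definition proper_fun :: "('a \<Rightarrow> ereal) \<Rightarrow> bool" where
  "proper_fun F \<longleftrightarrow> (\<forall>x. F x \<noteq> -\<infinity>) \<and> edom F \<noteq> {}"

definition lsc_fun :: "('a::topological_space \<Rightarrow> ereal) \<Rightarrow> bool" where
  "lsc_fun F \<longleftrightarrow> (\<forall>x. F x \<le> Liminf (at x) F)"

definition frechet_subdiff :: "('a::euclidean_space \<Rightarrow> ereal) \<Rightarrow> 'a \<Rightarrow> 'a set" where
  "frechet_subdiff F x =
     {u. \<bar>F x\<bar> \<noteq> \<infinity> \<and>
         0 \<le> Liminf (at x) (\<lambda>z. (F z - F x - ereal (u \<bullet> (z - x))) / ereal (norm (z - x)))}"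

definition limiting_subdiff :: "('a::euclidean_space \<Rightarrow> ereal) \<Rightarrow> 'a \<Rightarrow> 'a set" where
  "limiting_subdiff F x =
     {u. \<bar>F x\<bar> \<noteq> \<infinity> \<and>
         (\<exists>X U. X \<longlonglongrightarrow> x \<and> (\<lambda>k. F (X k)) \<longlonglongrightarrow> F x \<and>
                (\<forall>k. U k \<in> frechet_subdiff F (X k)) \<and> U \<longlonglongrightarrow> u)}"

text \<open>The distance to the origin is extended-real-valued, so that it is \<open>\<infinity>\<close> for the empty set
  (the library's \<^const>\<open>infdist\<close> would give \<open>0\<close>).\<close>

definition dist_origin :: "'a::real_normed_vector set \<Rightarrow> ereal" where
  "dist_origin S = (INF u\<in>S. ereal (norm u))"

definition desing :: "real \<Rightarrow> real \<Rightarrow> real \<Rightarrow> real" where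
  "desing c p s = c * s powr (1 - p)"

definition KL_property_at :: "('a::euclidean_space \<Rightarrow> ereal) \<Rightarrow> 'a \<Rightarrow> real \<Rightarrow> bool" where
  "KL_property_at Z w p \<longleftrightarrow>
     limiting_subdiff Z w \<noteq> {} \<and>
     (\<exists>\<eta>>0. \<exists>c>0. \<exists>U. open U \<and> w \<in> U \<and>
        (\<forall>w'\<in>U. 0 < Z w' - Z w \<and> Z w' - Z w < ereal \<eta> \<longrightarrow>
           ereal (deriv (desing c p) (real_of_ereal (Z w' - Z w)))
             * dist_origin (limiting_subdiff Z w') \<ge> 1))"

definition KL_function :: "('a::euclidean_space \<Rightarrow> ereal) \<Rightarrow> bool" where
  "KL_function Z \<longleftrightarrow>
     (\<forall>w. limiting_subdiff Z w \<noteq> {} \<longrightarrow> (\<exists>p. 0 \<le> p \<and> p < 1 \<and> KL_property_at Z w p))"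

definition gradient :: "('a::real_inner \<Rightarrow> real) \<Rightarrow> 'a \<Rightarrow> 'a" where
  "gradient f x = (THE D. GDERIV f x :> D)"

definition L_smooth :: "real \<Rightarrow> ('a::real_inner \<Rightarrow> real) \<Rightarrow> bool" where
  "L_smooth L f \<longleftrightarrow>
     (\<forall>x. f differentiable (at x)) \<and>
     (\<forall>x x'. norm (gradient f x - gradient f x') \<le> L * norm (x - x'))"

text \<open>On \<^typ>\<open>real ^ 'n\<close> the library's \<open>*\<close> is already the componentwise product, and \<open>1\<close> the
  all-ones vector.\<close>

definition vdiv :: "real ^ 'n \<Rightarrow> real ^ 'n \<Rightarrow> real ^ 'n" where
  "vdiv a b = (\<chi> i. a $ i / b $ i)"

definition vsqrt :: "real ^ 'n \<Rightarrow> real ^ 'n" where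
  "vsqrt a = (\<chi> i. sqrt (a $ i))"

definition vmin :: "real ^ 'n \<Rightarrow> real" where
  "vmin a = Min (range (\<lambda>i. a $ i))"

text \<open>\<open>wnorm2 w x\<close> is the squared weighted norm of \<open>x\<close>; the weights may be negative.\<close>

definition wnorm2 :: "real ^ 'n \<Rightarrow> real ^ 'n \<Rightarrow> real" where
  "wnorm2 w x = (\<Sum>i\<in>UNIV. (x $ i)\<^sup>2 * w $ i)"

definition finite_avg :: "nat \<Rightarrow> (nat \<Rightarrow> 'a \<Rightarrow> real) \<Rightarrow> 'a \<Rightarrow> real" where
  "finite_avg N fs x = (1 / real N) * (\<Sum>i=1..N. fs i x)"

definition is_argmin :: "('a \<Rightarrow> ereal) \<Rightarrow> 'a \<Rightarrow> bool" where
  "is_argmin F = is_arg_min F (\<lambda>_. True)"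

definition Prox :: "(real ^ 'n \<Rightarrow> ereal) \<Rightarrow> real ^ 'n \<Rightarrow> real ^ 'n \<Rightarrow> (real ^ 'n) set" where
  "Prox h a v = {x. is_argmin (\<lambda>z. h z + ereal (1/2 * wnorm2 v (z - a))) x}"

text \<open>In \<open>AEPG\<close> the sequence \<open>\<sigma>\<close> is shifted by one so that it starts at index \<open>-1\<close>: \<open>\<sigma> t\<close> stands
  for \<open>\<sigma>\<^sup>t\<^sup>-\<^sup>1\<close>.  With \<open>x\<^sup>-\<^sup>1 = x\<^sup>0\<close>, the truncated \<open>x (t - 1)\<close> is the previous iterate for every \<open>t\<close>,
  including \<open>t = 0\<close>.\<close>

definition AEPG_d :: "(nat \<Rightarrow> real ^ 'n) \<Rightarrow> nat \<Rightarrow> real ^ 'n" where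
  "AEPG_d x t = x (Suc t) - x t"

definition AEPG_r :: "(nat \<Rightarrow> real ^ 'n) \<Rightarrow> (nat \<Rightarrow> real ^ 'n) \<Rightarrow> nat \<Rightarrow> real ^ 'n" where
  "AEPG_r x v t = v t * AEPG_d x t"

definition AEPG_s ::
  "real \<Rightarrow> real \<Rightarrow> (nat \<Rightarrow> real ^ 'n) \<Rightarrow> (nat \<Rightarrow> real ^ 'n) \<Rightarrow> nat \<Rightarrow> real ^ 'n" where
  "AEPG_s \<alpha> \<beta> x v t =
     (\<alpha> * (norm (AEPG_r x v t))\<^sup>2) *\<^sub>R 1 + \<beta> *\<^sub>R (AEPG_r x v t * AEPG_r x v t)"

definition AEPG ::
  "(real ^ 'n \<Rightarrow> real) \<Rightarrow> (real ^ 'n \<Rightarrow> ereal) \<Rightarrow> real \<Rightarrow> real \<Rightarrow> real \<Rightarrow> real \<Rightarrow>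
   (nat \<Rightarrow> real ^ 'n) \<Rightarrow> (nat \<Rightarrow> real ^ 'n) \<Rightarrow> (nat \<Rightarrow> real ^ 'n) \<Rightarrow> (nat \<Rightarrow> real) \<Rightarrow> bool" where
  "AEPG f h v0 \<alpha> \<beta> \<theta> x y v \<sigma> \<longleftrightarrow>
     v 0 = v0 *\<^sub>R 1 \<and> y 0 = x 0 \<and> \<sigma> 0 = \<theta> \<and>
     (\<forall>t. x (Suc t) \<in> Prox h (y t - vdiv (gradient f (y t)) (v t)) (v t)) \<and>
     (\<forall>t. v (Suc t) = vsqrt (v 0 * v 0 + (\<Sum>i\<le>t. AEPG_s \<alpha> \<beta> x v i))) \<and>
     (\<forall>t. \<sigma> (Suc t) = \<theta> * (1 - \<sigma> t) * vmin (vdiv (v t) (v (Suc t)))) \<and>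
     (\<forall>t. y (Suc t) = x (Suc t) + \<sigma> (Suc t) *\<^sub>R AEPG_d x t)"

definition KL_Z ::
  "(real ^ 'n \<Rightarrow> ereal) \<Rightarrow> real ^ 'n \<Rightarrow> real \<Rightarrow>
   (real ^ 'n) \<times> (real ^ 'n) \<times> real \<times> (real ^ 'n) \<Rightarrow> ereal" where
  "KL_Z F xbar L = (\<lambda>(x, x', \<sigma>, v).
     F x - F xbar + ereal (1/2 * wnorm2 (\<sigma> *\<^sub>R (v + L *\<^sub>R 1)) (x - x')))"

definition AEPG_W ::
  "(nat \<Rightarrow> real ^ 'n) \<Rightarrow> (nat \<Rightarrow> real ^ 'n) \<Rightarrow> (nat \<Rightarrow> real) \<Rightarrow> nat \<Rightarrow>
   (real ^ 'n) \<times> (real ^ 'n) \<times> real \<times> (real ^ 'n)" where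
  "AEPG_W x v \<sigma> t = (x t, x (t - 1), \<sigma> t, v t)"

end

theory Submission
  imports Defs
begin

text \<open>The value of \<open>\<Z>\<close> along the iterates decreases by at least \<open>\<xi>\<parallel>d\<^sup>t\<parallel>\<^sup>2\<close> per step once \<open>v\<^sup>t\<close> is large
  enough, so \<open>\<parallel>d\<^sup>t\<parallel>\<^sup>2\<close> is summable; this bounds the weights \<open>v\<^sup>t\<close>, which are increasing, and makes
  \<open>v\<^sup>t\<close> and \<open>\<sigma>\<^sup>t\<close> converge.  The proximal step provides a subgradient of \<open>\<Z>\<close> at \<open>W\<^sup>t\<^sup>+\<^sup>1\<close> of norm
  \<open>O(\<parallel>d\<^sup>t\<parallel> + \<parallel>d\<^sup>t\<^sup>-\<^sup>1\<parallel>)\<close>, hence every cluster point of \<open>W\<^sup>t\<close> is critical and the KL inequality becomes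
  \<open>(\<Z>(W\<^sup>t) - \<Z>\<^sup>\<infinity>)\<^sup>p \<le> K(\<parallel>d\<^sup>t\<^sup>-\<^sup>1\<parallel> + \<parallel>d\<^sup>t\<^sup>-\<^sup>2\<parallel>)\<close>.  Concavity of \<open>s \<mapsto> s\<^sup>1\<^sup>-\<^sup>p\<close> then gives finite length,
  and the tails \<open>R\<^sub>t = \<Sum>\<^sub>k\<^sub>\<ge>\<^sub>t \<parallel>d\<^sup>k\<parallel>\<close> satisfy a recursive inequality between \<open>R\<^sub>t\<close> and \<open>R\<^sub>t - R\<^sub>t\<^sub>+\<^sub>2\<close> whose
  exponent determines the rate.\<close>

section \<open>Sequences with sufficient descent and a KL inequality\<close>

text \<open>This is the tangent inequality at a for the concave function s^(1-p), multiplied by a^p.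
  It reduces to Young's inequality, with b = 0 immediate.\<close>

lemma powr_concave_diff:
  fixes a b p :: real
  assumes "0 < a" "0 \<le> b" "0 \<le> p" "p < 1"
  shows "(1 - p) * (a - b) \<le> a powr p * (a powr (1 - p) - b powr (1 - p))"
proof -
  have "a powr p * b powr (1 - p) \<le> p * a + (1 - p) * b"
  proof (cases "b = 0")
    case False
    then show ?thesis using Youngs_inequality_0[of p "1 - p" a b] assms by auto
  qed (use assms in simp)
  moreover have "a powr p * a powr (1 - p) = a"
    using assms by (simp flip: powr_add)
  ultimately show ?thesis by (simp add: algebra_simps)
qed

lemma le_avg_of_square_le_mult:
  fixes e a b :: real
  assumes "0 \<le> a" "0 \<le> b" "e\<^sup>2 \<le> a * b"
  shows "e \<le> (a + b) / 2"
proof (rule power2_le_imp_le)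
  have "a * b \<le> ((a + b) / 2)\<^sup>2"
    using zero_le_power2[of "a - b"] by (simp add: power2_eq_square field_simps)
  then show "e\<^sup>2 \<le> ((a + b) / 2)\<^sup>2" using assms(3) by linarith
qed (use assms in simp)

lemma telescope_summable:
  fixes e G :: "nat \<Rightarrow> real"
  assumes "\<And>t. 0 \<le> e t" "\<And>t. 0 \<le> G t" "\<And>t. e t \<le> G t - G (Suc t)"
  shows "summable e" "(\<Sum>k. e (k + t)) \<le> G t"
proof -
  have partial: "(\<Sum>k<n. e (k + s)) \<le> G s - G (n + s)" for n s
  proof (induction n)
    case (Suc n)
    then show ?case using assms(3)[of "n + s"] by simp
  qed simp
  have bd: "(\<Sum>k<n. e (k + s)) \<le> G s" for n s
    using partial[of s n] assms(2)[of "n + s"] by linarith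
  show sm: "summable e"
    using summableI_nonneg_bounded[of e "G 0"] assms(1) bd[of 0] by simp
  then have "summable (\<lambda>k. e (k + t))" by (rule summable_ignore_initial_segment)
  then show "(\<Sum>k. e (k + t)) \<le> G t"
    using bd by (intro suminf_le_const) auto
qed

text \<open>The indices are offset: \<open>D t\<close> is the gap in value after the two steps
  \<open>e t\<close> and \<open>e (Suc t)\<close>, so descent from \<open>D t\<close> controls
  \<open>e (t + 2)\<close>. Concavity merges descent and KL into a bound of e(t+2)^2 by the drop of
  \<open>\<phi>\<close> times \<open>e t + e (Suc t)\<close>; AM-GM then makes the steps
  telescope.\<close>

lemma kl_descent_finite_length:
  fixes e D :: "nat \<Rightarrow> real"
  assumes e: "\<And>t. 0 \<le> e t" and D: "\<And>t. 0 \<le> D t" and "0 < \<xi>" "0 < K" "0 \<le> p" "p < 1"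
    and descent: "\<And>t. \<xi> * (e (t + 2))\<^sup>2 \<le> D t - D (Suc t)"
    and kl: "\<And>t. D t powr p \<le> K * (e t + e (Suc t))"
  shows "summable e"
    and "\<exists>B>0. \<forall>t. (\<Sum>k. e (k + t)) \<le> B * D t powr (1 - p) + 2 * (e t + e (Suc t))"
proof -
  define A where "A = K / (\<xi> * (1 - p))"
  define \<phi> where "\<phi> t = D t powr (1 - p)" for t
  \<comment> \<open>The weights 5/4 and 2 make \<open>G t - G (Suc t)\<close> equal to 4 A times the
    drop of \<open>\<phi>\<close> plus 5/4 e(t) + 3/4 e(t+1) - 2 e(t+2), of which at least e(t)
    survives the AM-GM bound on 2 e(t+2).\<close>
  define G where "G t = 4 * A * \<phi> t + 5/4 * e t + 2 * e (Suc t)" for t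
  have A: "A > 0" using assms by (simp add: A_def)
  have dec: "D (Suc t) \<le> D t" for t
    using descent[of t] \<open>0 < \<xi>\<close> by (smt (verit) mult_nonneg_nonneg zero_le_power2)
  have phi_dec: "\<phi> (Suc t) \<le> \<phi> t" for t
    unfolding \<phi>_def using dec D \<open>p < 1\<close> by (intro powr_mono2) auto
  have sq: "(e (t + 2))\<^sup>2 \<le> A * (\<phi> t - \<phi> (Suc t)) * (e t + e (Suc t))" for t
  proof (cases "D t = 0")
    case True
    \<comment> \<open>The tangent inequality needs a positive base point. Here both gaps vanish and
      descent forces e(t+2) = 0.\<close>
    with dec[of t] D[of "Suc t"] have "D (Suc t) = 0" by simp
    with True descent[of t] \<open>0 < \<xi>\<close> show ?thesis
      by (simp add: \<phi>_def mult_le_0_iff)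
  next
    case False
    then have "D t > 0" using D[of t] by linarith
    have "(1 - p) * (\<xi> * (e (t + 2))\<^sup>2) \<le> (1 - p) * (D t - D (Suc t))"
      using descent[of t] \<open>p < 1\<close> by (intro mult_left_mono) auto
    also have "\<dots> \<le> D t powr p * (\<phi> t - \<phi> (Suc t))"
      unfolding \<phi>_def using \<open>D t > 0\<close> D assms by (intro powr_concave_diff) auto
    also have "\<dots> \<le> K * (e t + e (Suc t)) * (\<phi> t - \<phi> (Suc t))"
      using kl[of t] phi_dec[of t] by (intro mult_right_mono) auto
    finally show ?thesis
      using assms(3,6) by (simp add: A_def field_simps)
  qed
  have step: "e t \<le> G t - G (Suc t)" for t
  proof -
    \<comment> \<open>Splitting the product with factors 4 and 1/4 leaves so small a multiple of the
      two earlier steps that it can be absorbed.\<close>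
    have "(e (t + 2))\<^sup>2 \<le> (4 * A * (\<phi> t - \<phi> (Suc t))) * ((e t + e (Suc t)) / 4)"
      using sq[of t] by simp
    then have "e (t + 2) \<le> (4 * A * (\<phi> t - \<phi> (Suc t)) + (e t + e (Suc t)) / 4) / 2"
      using phi_dec[of t] A e by (intro le_avg_of_square_le_mult) auto
    then have "2 * e (t + 2) \<le> 4 * (A * \<phi> t) - 4 * (A * \<phi> (Suc t)) + (e t + e (Suc t)) / 4"
      by (simp add: algebra_simps)
    moreover have "G t - G (Suc t) = 4 * (A * \<phi> t) - 4 * (A * \<phi> (Suc t))
        + 5/4 * e t + 3/4 * e (Suc t) - 2 * e (t + 2)"
      by (simp add: G_def)
    ultimately show ?thesis using e[of t] e[of "Suc t"] by argo
  qed
  have G: "0 \<le> G t" for t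
    using A e unfolding G_def \<phi>_def by (intro add_nonneg_nonneg) auto
  show "summable e" using telescope_summable(1)[of e G, OF e G step] .
  show "\<exists>B>0. \<forall>t. (\<Sum>k. e (k + t)) \<le> B * D t powr (1 - p) + 2 * (e t + e (Suc t))"
  proof (intro exI[of _ "4 * A"] conjI allI)
    fix t
    show "(\<Sum>k. e (k + t)) \<le> 4 * A * D t powr (1 - p) + 2 * (e t + e (Suc t))"
      using telescope_summable(2)[of e G t, OF e G step] e[of t] unfolding G_def \<phi>_def by simp
  qed (use A in simp)
qed

section \<open>Rates from two-step recursions\<close>

text \<open>The recursion contracts \<open>R\<close> by q = 1 - 1/M over two indices, so the ratio
  per index is the square root of q.\<close>

lemma two_step_linear_rate:
  fixes R :: "nat \<Rightarrow> real"
  assumes R: "\<And>t. 0 \<le> R t" and rec: "\<And>t. R t \<le> B * (R t - R (t + 2))"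
    and dec: "\<And>t. R (t + 2) \<le> R t"
  shows "\<exists>\<rho> C. 0 < \<rho> \<and> \<rho> < 1 \<and> 0 < C \<and> (\<forall>t. R t \<le> C * \<rho> ^ t)"
proof -
  \<comment> \<open>Enlarging \<open>B\<close> to at least 2 keeps q strictly between 0 and
    1.\<close>
  define M where "M = max B 2"
  define q where "q = 1 - 1 / M"
  define \<rho> where "\<rho> = sqrt q"
  have M: "M \<ge> 2" by (simp add: M_def)
  then have q: "0 < q" "q < 1" by (auto simp: q_def field_simps)
  then have \<rho>: "0 < \<rho>" "\<rho> < 1" "\<rho>\<^sup>2 = q" by (auto simp: \<rho>_def)
  have step: "R (t + 2) \<le> q * R t" for t
  proof -
    have "R t \<le> M * (R t - R (t + 2))"
      using rec[of t] mult_right_mono[of B M "R t - R (t + 2)"] dec[of t] by (simp add: M_def)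
    then show ?thesis using M by (simp add: q_def field_simps)
  qed
  \<comment> \<open>Even and odd indices evolve separately, so \<open>C\<close> has to dominate both
    starting values.\<close>
  define C where "C = 1 + R 0 + R 1 / \<rho>"
  have C: "C > 0" using R[of 0] R[of 1] \<rho> by (simp add: C_def add_pos_nonneg)
  have "R t \<le> C * \<rho> ^ t" for t
  proof (induction t rule: induct_nat_012)
    case 0
    then show ?case using R[of 1] \<rho> by (simp add: C_def)
  next
    case 1
    have "R 1 = R 1 / \<rho> * \<rho>" using \<rho> by simp
    also have "\<dots> \<le> C * \<rho>"
      using \<rho> R[of 0] by (intro mult_right_mono) (auto simp: C_def)
    finally show ?case by simp
  next
    case (ge2 t)
    have "R (Suc (Suc t)) \<le> q * (C * \<rho> ^ t)"
      using order_trans[OF step[of t] mult_left_mono[OF ge2(1), of q]] q by simp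
    also have "\<dots> = C * \<rho> ^ Suc (Suc t)"
      by (simp add: power2_eq_square flip: \<rho>(3))
    finally show ?case .
  qed
  then show ?thesis using \<rho> C by blast
qed

lemma powr_neg_diff_le:
  fixes t s :: real
  assumes "0 < t" "0 < s"
  shows "t powr (- s) - (t + 2) powr (- s) \<le> 2 * s * t powr (- s - 1)"
proof -
  have "\<exists>z>t. z < t + 2 \<and> (t + 2) powr (- s) - t powr (- s)
          = (t + 2 - t) * (- s * z powr (- s - 1))"
    using assms by (intro MVT2) (auto intro!: derivative_eq_intros simp: powr_diff field_simps)
  then obtain z where z: "z > t" 
    and eq: "t powr (- s) - (t + 2) powr (- s) = 2 * s * z powr (- s - 1)" by auto
  have "z powr (- s - 1) \<le> t powr (- s - 1)"
    using z assms by (intro powr_mono2') auto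
  then show ?thesis using eq assms by simp
qed

text \<open>If R(t+2) exceeded C (t+2)^(-s), the recursion would force a drop of order C^((s+1)/s)
  t^(-s-1), while C t^(-s) loses only order C t^(-s-1) over two indices. For large \<open>C\<close>
  this is a contradiction.\<close>

lemma two_step_sublinear_rate:
  fixes R :: "nat \<Rightarrow> real"
  assumes R: "\<And>t. 0 \<le> R t" and "0 < s" "0 < B"
    and rec: "\<And>t. R (t + 2) powr ((s + 1) / s) \<le> B * (R t - R (t + 2))"
  shows "\<exists>C>0. \<forall>t\<ge>1. R t \<le> C * real t powr (- s)"
proof -
  define \<tau> where "\<tau> = (s + 1) / s"
  \<comment> \<open>The factor 2 s comes from the mean value bound, \<open>B\<close> from the
    recursion and 3^(s+1) from t + 2 \<le> 3 t.\<close>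
  define C0 where "C0 = 2 * B * s * 3 powr (s + 1)"
  \<comment> \<open>The entries serve the induction step and the base cases t = 1 and t = 2, in this
    order.\<close>
  define C where "C = max (C0 powr s) (max (R 1) (2 powr s * R 2))"
  have C0: "C0 > 0" using assms by (simp add: C0_def)
  then have "C0 powr s > 0" by simp
  then have C: "C > 0" unfolding C_def by linarith
  have "C0 = (C0 powr s) powr (1/s)" using C0 assms by (simp add: powr_powr)
  also have "\<dots> \<le> C powr (1/s)"
    using assms by (intro powr_mono2) (auto simp: C_def)
  finally have C0C: "C0 \<le> C powr (1/s)" .
  have "R (Suc k) \<le> C * real (Suc k) powr (- s)" for k
  proof (induction k rule: induct_nat_012)
    case 0
    then show ?case by (simp add: C_def)
  next
    case 1
    have "R 2 = 2 powr s * R 2 * 2 powr (- s)" by (simp add: powr_minus)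
    also have "\<dots> \<le> C * 2 powr (- s)" by (intro mult_right_mono) (auto simp: C_def)
    finally show ?case by (simp add: numeral_2_eq_2)
  next
    case (ge2 k)
    define t where "t = Suc k"
    have t: "real t \<ge> 1" "t + 2 = Suc (Suc (Suc k))" by (auto simp: t_def)
    have "R (t + 2) \<le> C * real (t + 2) powr (- s)"
    proof (rule ccontr)
      assume "\<not> ?thesis"
      then have gt: "C * (real t + 2) powr (- s) < R (t + 2)" by (simp add: add.commute)
      have "C powr \<tau> * (real t + 2) powr (- s - 1) = (C * (real t + 2) powr (- s)) powr \<tau>"
      proof -
        \<comment> \<open>The exponent (s+1)/s is the one that turns the order of t^(-s) into the
          order of its derivative.\<close>
        have "- s * \<tau> = - s - 1" using assms(2) by (simp add: \<tau>_def)
        then show ?thesis using C t by (simp add: powr_mult powr_powr)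
      qed
      also have "\<dots> \<le> R (t + 2) powr \<tau>"
        using gt C assms(2) by (intro powr_mono2) (auto simp: \<tau>_def)
      also have "\<dots> \<le> B * (R t - R (t + 2))" using rec unfolding \<tau>_def .
      also have "\<dots> < B * (C * real t powr (- s) - C * (real t + 2) powr (- s))"
        using ge2(1) gt assms(3) by (intro mult_strict_left_mono) (auto simp: t_def)
      also have "\<dots> = B * C * (real t powr (- s) - (real t + 2) powr (- s))"
        by (simp add: algebra_simps)
      also have "\<dots> \<le> B * C * (2 * s * real t powr (- s - 1))"
        using t C assms by (intro mult_left_mono powr_neg_diff_le) auto
      finally have *: "C powr \<tau> * (real t + 2) powr (- s - 1) < 2 * B * s * C * real t powr (- s - 1)"
        by (simp add: algebra_simps)
      have "3 powr (- s - 1) * real t powr (- s - 1) = (3 * real t) powr (- s - 1)"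
        by (simp add: powr_mult)
      also have "\<dots> \<le> (real t + 2) powr (- s - 1)"
        using t assms by (intro powr_mono2') auto
      finally have "C powr \<tau> * (3 powr (- s - 1) * real t powr (- s - 1))
          < 2 * B * s * C * real t powr (- s - 1)"
        using * mult_left_mono[of _ _ "C powr \<tau>"] by (smt (verit) powr_ge_zero)
      then have "(C powr \<tau> * 3 powr (- s - 1)) * real t powr (- s - 1)
          < (2 * B * s * C) * real t powr (- s - 1)" by (simp add: algebra_simps)
      then have "C powr \<tau> * 3 powr (- s - 1) < 2 * B * s * C"
        by (simp add: mult_less_cancel_right)
      moreover have "C powr \<tau> = C * C powr (1/s)"
      proof -
        have "\<tau> = 1 + 1/s" using assms by (simp add: \<tau>_def field_simps)
        then show ?thesis using C by (simp add: powr_add)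
      qed
      ultimately have "C powr (1/s) * 3 powr (- s - 1) < 2 * B * s" using C by simp
      then have "C powr (1/s) * 3 powr (- s - 1) * 3 powr (s + 1) < C0"
        unfolding C0_def by (intro mult_strict_right_mono) auto
      then have "C powr (1/s) < C0"
        by (simp add: mult.assoc flip: powr_add)
      with C0C show False by simp
    qed
    then show ?case using t(2) by simp
  qed
  then have "\<forall>t\<ge>1. R t \<le> C * real t powr (- s)"
    by (metis One_nat_def Suc_le_D)
  then show ?thesis using C by blast
qed

text \<open>The tail is bounded by B D^(1-p) + 2 E with E = R(t) - R(t+2), and KL gives D^(1-p)
  \<le> (K E)^q for q = (1-p)/p. Whether E or E^q dominates for small E separates the linear from
  the sublinear rate.\<close>

lemma kl_descent_rates:
  fixes e D R :: "nat \<Rightarrow> real"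
  assumes e: "\<And>t. 0 \<le> e t" and D: "\<And>t. 0 \<le> D t" and "0 < \<xi>" "0 < K" "0 \<le> p" "p < 1"
    and descent: "\<And>t. \<xi> * (e (t + 2))\<^sup>2 \<le> D t - D (Suc t)"
    and kl: "\<And>t. D t powr p \<le> K * (e t + e (Suc t))"
    and R_def: "\<And>t. R t = (\<Sum>k. e (k + t))"
  shows "p = 0 \<Longrightarrow> \<exists>k. \<forall>t\<ge>k. e t = 0"
    and "0 < p \<Longrightarrow> p \<le> 1/2 \<Longrightarrow> \<exists>\<rho> C. 0 < \<rho> \<and> \<rho> < 1 \<and> 0 < C \<and> (\<forall>t. R t \<le> C * \<rho> ^ t)"
    and "1/2 < p \<Longrightarrow> \<exists>C>0. \<forall>t\<ge>1. R t \<le> C * real t powr (- ((1 - p) / (2 * p - 1)))"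
proof -
  note length = kl_descent_finite_length[of e D \<xi> K p, OF e D assms(3-6) descent kl]
  note sm = length(1)
  have R_nonneg: "0 \<le> R t" for t
    unfolding R_def using sm e by (intro suminf_nonneg summable_ignore_initial_segment)
  have R_Suc: "R t = e t + R (Suc t)" for t
    using suminf_split_head[OF summable_ignore_initial_segment[OF sm, of t]] by (simp add: R_def)
  define E where "E t = e t + e (Suc t)" for t
  have E: "R t - R (t + 2) = E t" "0 \<le> E t" for t
    using R_Suc[of t] R_Suc[of "Suc t"] e by (auto simp: E_def)
  have R_dec: "R (t + 2) \<le> R t" for t
    using E[of t] by linarith
  have R0: "R t \<le> R 0" for t
  proof (induction t)
    case (Suc t)
    then show ?case using R_Suc[of t] e[of t] by linarith
  qed simp
  define M where "M = R 0 + 1"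
  have M: "0 < M" "E t \<le> M" for t
    using R_nonneg[of "t + 2"] R_nonneg[of 0] R0[of t] E(1)[of t] by (auto simp: M_def)
  from length(2) obtain B where B: "0 < B" "\<And>t. R t \<le> B * D t powr (1 - p) + 2 * E t"
    unfolding R_def E_def by blast
  {
    assume "p = 0"
    have "(\<lambda>t. K * E t) \<longlonglongrightarrow> K * (0 + 0)"
      unfolding E_def using summable_LIMSEQ_zero[OF sm]
      by (intro tendsto_intros LIMSEQ_Suc)
    then have "eventually (\<lambda>t. K * E t < 1) sequentially"
      by (intro order_tendstoD) auto
    then obtain k where k: "\<And>t. t \<ge> k \<Longrightarrow> K * E t < 1"
      by (auto simp: eventually_sequentially)
    have "e t = 0" if "t \<ge> k + 2" for t
    proof -
      define s where "s = t - 2"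
      have s: "t = s + 2" "s \<ge> k" using that by (auto simp: s_def)
      \<comment> \<open>A nonzero gap raised to the power 0 is 1, so KL would read 1 \<le> K E,
        which fails for late indices.\<close>
      have "D s = 0"
      proof (rule ccontr)
        assume "D s \<noteq> 0"
        with kl[of s] k[of s] s \<open>p = 0\<close> show False by (simp add: E_def)
      qed
      with descent[of s] D[of "Suc s"] s have "\<xi> * (e t)\<^sup>2 \<le> 0" by simp
      with \<open>0 < \<xi>\<close> show ?thesis by (simp add: mult_le_0_iff)
    qed
    then show "\<exists>k. \<forall>t\<ge>k. e t = 0" by blast
  }
  define q where "q = (1 - p) / p"
  have D_le: "D t powr (1 - p) \<le> (K * E t) powr q" if "0 < p" for t
  proof -
    have "D t powr (1 - p) = (D t powr p) powr q"
      using that by (simp add: powr_powr q_def)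
    also have "\<dots> \<le> (K * E t) powr q"
      using kl[of t] that assms(6) by (intro powr_mono2) (auto simp: q_def E_def)
    finally show ?thesis .
  qed
  {
    assume p: "0 < p" "p \<le> 1/2"
    \<comment> \<open>As E is bounded by \<open>M\<close>, an exponent q \<ge> 1 makes (K E)^q at
      most a constant times E.\<close>
    then have q: "q \<ge> 1" by (simp add: q_def field_simps)
    have "R t \<le> (B * (K * (K * M) powr (q - 1)) + 2) * (R t - R (t + 2))" for t
    proof -
      have "(K * E t) powr q = (K * E t) * (K * E t) powr (q - 1)"
        using E(2)[of t] assms(4) by (simp add: powr_diff)
      also have "\<dots> \<le> (K * E t) * (K * M) powr (q - 1)"
        using E(2)[of t] assms(4) M q by (intro mult_left_mono powr_mono2) auto
      finally have "B * D t powr (1 - p) \<le> B * ((K * E t) * (K * M) powr (q - 1))"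
        using D_le[OF p(1), of t] B(1) by (intro mult_left_mono) auto
      with B(2)[of t] show ?thesis unfolding E(1) by (simp add: algebra_simps)
    qed
    from two_step_linear_rate[of R, OF R_nonneg this R_dec]
    show "\<exists>\<rho> C. 0 < \<rho> \<and> \<rho> < 1 \<and> 0 < C \<and> (\<forall>t. R t \<le> C * \<rho> ^ t)" .
  }
  {
    assume p: "1/2 < p"
    define s where "s = (1 - p) / (2 * p - 1)"
    have s: "s > 0" using p assms(6) by (simp add: s_def)
    \<comment> \<open>Now E = E^q E^(1-q) \<le> M^(1-q) E^q, so the linear term is absorbed. Raising
      R \<le> A E^q to the power 1/q = (s+1)/s yields the sublinear recursion.\<close>
    have q: "0 < q" "q < 1" using p assms(6) by (auto simp: q_def field_simps)
    have "s + 1 = p / (2 * p - 1)" using p by (simp add: s_def field_simps)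
    then have qs: "1 / q = (s + 1) / s" using p assms(6) by (simp add: q_def s_def)
    define A where "A = B * K powr q + 2 * M powr (1 - q)"
    have A: "A > 0" unfolding A_def using B(1) assms(4) M by (intro add_pos_pos) auto
    have "R t \<le> A * E t powr q" for t
    proof -
      have "E t = E t powr q * E t powr (1 - q)"
        using E(2)[of t] by (cases "E t = 0") (auto simp flip: powr_add)
      also have "\<dots> \<le> E t powr q * M powr (1 - q)"
        using E(2)[of t] M q by (intro mult_left_mono powr_mono2) auto
      finally have "2 * E t \<le> 2 * (E t powr q * M powr (1 - q))" by simp
      moreover have "B * D t powr (1 - p) \<le> B * (K powr q * E t powr q)"
        using D_le[of t] p B(1) by (simp add: powr_mult)
      ultimately show ?thesis using B(2)[of t] by (simp add: A_def algebra_simps)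
    qed
    then have "R (t + 2) powr (1 / q) \<le> (A * E t powr q) powr (1 / q)" for t
      using R_dec[of t] R_nonneg[of "t + 2"] q by (intro powr_mono2) (auto intro: order_trans)
    moreover have "(A * E t powr q) powr (1 / q) = A powr (1 / q) * (R t - R (t + 2))" for t
      unfolding E(1) using E(2)[of t] A q by (simp add: powr_mult powr_powr)
    ultimately have "R (t + 2) powr ((s + 1) / s) \<le> A powr (1 / q) * (R t - R (t + 2))" for t
      unfolding qs by metis
    from two_step_sublinear_rate[of R, OF R_nonneg s _ this] A
    show "\<exists>C>0. \<forall>t\<ge>1. R t \<le> C * real t powr (- ((1 - p) / (2 * p - 1)))"
      by (simp add: s_def)
  }
qed

lemma dist_limit_le_tail:
  fixes x :: "nat \<Rightarrow> 'a :: banach"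
  assumes "summable (\<lambda>t. norm (x (Suc t) - x t))"
  shows "convergent x"
    and "x \<longlonglongrightarrow> l \<Longrightarrow> norm (x t - l) \<le> (\<Sum>k. norm (x (Suc (k + t)) - x (k + t)))"
proof -
  have sm: "summable (\<lambda>k. norm (x (Suc (k + t)) - x (k + t)))" for t
    using summable_ignore_initial_segment[OF assms, of t] by simp
  have "summable (\<lambda>t. x (Suc t) - x t)" using assms by (rule summable_norm_cancel)
  then have "convergent (\<lambda>n. \<Sum>k<n. x (Suc k) - x k)" by (simp add: summable_iff_convergent)
  then have "convergent (\<lambda>n. (x n - x 0) + x 0)"
    by (subst (asm) sum_lessThan_telescope) (intro convergent_add convergent_const)
  then show "convergent x" by simp
  assume l: "x \<longlonglongrightarrow> l"
  have "norm (x t - x (n + t)) \<le> (\<Sum>k. norm (x (Suc (k + t)) - x (k + t)))" for n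
  proof -
    have "(\<Sum>k<n. x (Suc (k + t)) - x (k + t)) = x (n + t) - x t"
      using sum_lessThan_telescope[of "\<lambda>k. x (k + t)" n] by simp
    then have "norm (x t - x (n + t)) = norm (\<Sum>k<n. x (Suc (k + t)) - x (k + t))"
      by (simp add: norm_minus_commute)
    also have "\<dots> \<le> (\<Sum>k<n. norm (x (Suc (k + t)) - x (k + t)))" by (rule norm_sum)
    also have "\<dots> \<le> (\<Sum>k. norm (x (Suc (k + t)) - x (k + t)))"
      using sm by (intro sum_le_suminf) auto
    finally show ?thesis .
  qed
  moreover have "(\<lambda>n. norm (x t - x (n + t))) \<longlonglongrightarrow> norm (x t - l)"
    using l by (intro tendsto_intros LIMSEQ_ignore_initial_segment)
  ultimately show "norm (x t - l) \<le> (\<Sum>k. norm (x (Suc (k + t)) - x (k + t)))"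
    by (intro LIMSEQ_le_const2) auto
qed

section \<open>Vectors, weighted norms and subgradients\<close>

lemma vmin_le: "vmin a \<le> a $ i"
  by (simp add: vmin_def)

lemma vmin_mem: "\<exists>i. vmin a = a $ i"
proof -
  have "vmin a \<in> range (\<lambda>i. a $ i)" unfolding vmin_def by (intro Min_in) auto
  then show ?thesis by auto
qed

lemma norm_sq_vec: "(norm (a :: real ^ 'n))\<^sup>2 = (\<Sum>i\<in>UNIV. (a $ i)\<^sup>2)"
  unfolding power2_norm_eq_inner inner_vec_def by (simp add: power2_eq_square)

lemma descent_inequality:
  fixes f :: "'a :: real_inner \<Rightarrow> real"
  assumes grad: "\<And>z. GDERIV f z :> G z"
    and lip: "\<And>z z'. norm (G z - G z') \<le> L * norm (z - z')"
  shows "f b \<le> f a + G a \<bullet> (b - a) + L / 2 * (norm (b - a))\<^sup>2"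
proof -
  \<comment> \<open>This is f along the segment minus the nonconstant terms of its quadratic upper
    model. The Lipschitz bound makes its derivative nonpositive on [0, 1].\<close>
  define \<phi> where "\<phi> s = f (a + s *\<^sub>R (b - a)) - s * (G a \<bullet> (b - a)) - L / 2 * s\<^sup>2 * (norm (b - a))\<^sup>2" for s
  have "\<phi> 1 \<le> \<phi> 0"
  proof (rule DERIV_nonpos_imp_nonincreasing[of 0 1 \<phi>])
    fix s :: real assume s: "0 \<le> s" "s \<le> 1"
    have "((\<lambda>s. f (a + s *\<^sub>R (b - a))) has_derivative (\<lambda>u. (u *\<^sub>R (b - a)) \<bullet> G (a + s *\<^sub>R (b - a)))) (at s)"
      by (rule has_derivative_compose[of _ "\<lambda>u. u *\<^sub>R (b - a)"])
         (use grad[of "a + s *\<^sub>R (b - a)"] in \<open>auto intro!: derivative_eq_intros simp: gderiv_def\<close>)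
    then have "((\<lambda>s. f (a + s *\<^sub>R (b - a))) has_real_derivative (b - a) \<bullet> G (a + s *\<^sub>R (b - a))) (at s)"
      by (simp add: has_field_derivative_def mult.commute[of _ "(b - a) \<bullet> _"] mult_commute_abs)
    then have "(\<phi> has_real_derivative ((b - a) \<bullet> G (a + s *\<^sub>R (b - a)) - G a \<bullet> (b - a) - L * s * (norm (b - a))\<^sup>2)) (at s)"
      unfolding \<phi>_def by (auto intro!: derivative_eq_intros)
    moreover have "(b - a) \<bullet> G (a + s *\<^sub>R (b - a)) - G a \<bullet> (b - a) \<le> L * s * (norm (b - a))\<^sup>2"
    proof -
      have "(b - a) \<bullet> G (a + s *\<^sub>R (b - a)) - G a \<bullet> (b - a) = (G (a + s *\<^sub>R (b - a)) - G a) \<bullet> (b - a)"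
        by (simp add: inner_diff inner_commute)
      also have "\<dots> \<le> norm (G (a + s *\<^sub>R (b - a)) - G a) * norm (b - a)"
        by (rule norm_cauchy_schwarz)
      also have "\<dots> \<le> L * norm (s *\<^sub>R (b - a)) * norm (b - a)"
        using lip[of "a + s *\<^sub>R (b - a)" a] by (intro mult_right_mono) auto
      finally show ?thesis using s by (simp add: power2_eq_square mult.assoc)
    qed
    ultimately show "\<exists>y. (\<phi> has_real_derivative y) (at s) \<and> y \<le> 0"
      by (metis diff_le_0_iff_le)
  qed simp
  then show ?thesis by (simp add: \<phi>_def)
qed

lemma two_mult_le_squares: "2 * a * b \<le> a\<^sup>2 + (b :: real)\<^sup>2"
  using zero_le_power2[of "a - b"] by (simp add: power2_diff)

lemma wnorm2_nonneg: "(\<And>i. 0 \<le> w $ i) \<Longrightarrow> 0 \<le> wnorm2 w a"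
  unfolding wnorm2_def by (intro sum_nonneg) auto

lemma norm_mult_vec_le: "norm (a * b) \<le> norm a * norm (b :: real ^ 'n)"
proof (rule power2_le_imp_le)
  have "(norm (a * b))\<^sup>2 \<le> (\<Sum>i\<in>UNIV. (a $ i)\<^sup>2 * (norm b)\<^sup>2)"
    unfolding norm_sq_vec[of "a * b"]
    by (auto intro!: sum_mono mult_left_mono simp: power_mult_distrib component_le_norm_cart
        simp flip: abs_le_square_iff)
  then show "(norm (a * b))\<^sup>2 \<le> (norm a * norm b)\<^sup>2"
    by (simp add: norm_sq_vec[of a] power_mult_distrib flip: sum_distrib_right)
qed simp

text \<open>A differentiable function touching \<open>F\<close> from below passes on its gradient:
  the difference quotients of \<open>F\<close> dominate those of \<open>G\<close>, which tend to
  0.\<close>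

lemma frechet_subdiff_minorant:
  fixes F :: "'a :: euclidean_space \<Rightarrow> ereal" and G :: "'a \<Rightarrow> real"
  assumes eq: "F w = ereal (G w)" and le: "\<And>z. ereal (G z) \<le> F z"
    and deriv: "(G has_derivative (\<lambda>d. u \<bullet> d)) (at w)"
  shows "u \<in> frechet_subdiff F w"
proof -
  let ?q = "\<lambda>z. (G z - G w - u \<bullet> (z - w)) / norm (z - w)"
  have "(?q \<longlongrightarrow> 0) (at w)"
    using deriv by (simp add: has_derivative_def divide_inverse mult.commute)
  then have "((\<lambda>z. ereal (?q z)) \<longlongrightarrow> ereal 0) (at w)" by (intro tendsto_intros)
  then have "0 = Liminf (at w) (\<lambda>z. ereal (?q z))"
    by (intro lim_imp_Liminf[symmetric]) (auto simp: zero_ereal_def)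
  also have "\<dots> \<le> Liminf (at w) (\<lambda>z. (F z - F w - ereal (u \<bullet> (z - w))) / ereal (norm (z - w)))"
  proof (intro Liminf_mono eventually_at_topological[THEN iffD2] exI[of _ UNIV] conjI ballI impI)
    fix z assume "z \<noteq> w"
    then have pos: "norm (z - w) > 0" by simp
    show "ereal (?q z) \<le> (F z - F w - ereal (u \<bullet> (z - w))) / ereal (norm (z - w))"
    proof (cases "F z")
      case (real r)
      then show ?thesis
        using le[of z] pos by (simp add: eq divide_right_mono)
    qed (use le[of z] pos in \<open>simp_all add: eq\<close>)
  qed auto
  finally show ?thesis by (simp add: frechet_subdiff_def eq)
qed

lemma frechet_subset_limiting: "frechet_subdiff F w \<subseteq> limiting_subdiff F w"
proof
  fix u assume u: "u \<in> frechet_subdiff F w"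
  then have "\<bar>F w\<bar> \<noteq> \<infinity>" by (simp add: frechet_subdiff_def)
  with u show "u \<in> limiting_subdiff F w"
    unfolding limiting_subdiff_def
    by (intro CollectI conjI exI[of _ "\<lambda>_. w"] exI[of _ "\<lambda>_. u"]) auto
qed

lemma dist_origin_le: "u \<in> S \<Longrightarrow> dist_origin S \<le> ereal (norm u)"
  unfolding dist_origin_def by (rule INF_lower)

lemma wnorm2_le: "\<bar>wnorm2 w a\<bar> \<le> norm w * (norm a)\<^sup>2"
proof -
  have "\<bar>wnorm2 w a\<bar> \<le> (\<Sum>i\<in>UNIV. \<bar>(a $ i)\<^sup>2 * w $ i\<bar>)"
    unfolding wnorm2_def by (rule sum_abs)
  also have "\<dots> \<le> (\<Sum>i\<in>UNIV. (a $ i)\<^sup>2 * norm w)"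
    using component_le_norm_cart[of w] by (intro sum_mono) (simp add: abs_mult mult_left_mono)
  finally show ?thesis by (simp add: norm_sq_vec flip: sum_distrib_right) (simp add: mult.commute)
qed

lemma norm_Pair_le_sum: "norm (a, b) \<le> norm a + norm b"
  using sqrt_add_le_add_sqrt[of "(norm a)\<^sup>2" "(norm b)\<^sup>2"] by (simp add: norm_prod_def)

lemma wnorm2_has_derivative [derivative_intros]:
  fixes W A :: "'a :: real_normed_vector \<Rightarrow> real ^ 'n"
  assumes "(W has_derivative W') (at z within S)" "(A has_derivative A') (at z within S)"
  shows "((\<lambda>z. wnorm2 (W z) (A z)) has_derivative
    (\<lambda>d. (2 *\<^sub>R (W z * A z)) \<bullet> A' d + (A z * A z) \<bullet> W' d)) (at z within S)"
  unfolding wnorm2_def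
  by (auto intro!: derivative_eq_intros assms
        bounded_linear.has_derivative[OF bounded_linear_vec_nth]
      simp: inner_vec_def sum_distrib_left power2_eq_square algebra_simps simp flip: sum.distrib)

lemma wnorm2_tendsto_0:
  assumes "(w \<longlonglongrightarrow> w0)" "(a \<longlonglongrightarrow> 0)"
  shows "(\<lambda>t. wnorm2 (w t) (a t)) \<longlonglongrightarrow> 0"
proof -
  have "(\<lambda>t. wnorm2 (w t) (a t)) \<longlonglongrightarrow> wnorm2 w0 0"
    unfolding wnorm2_def by (intro tendsto_intros assms)
  then show ?thesis by (simp add: wnorm2_def)
qed

text \<open>\<open>lsc_fun\<close> speaks of punctured neighbourhoods, whereas the sequence may hit
  \<open>a\<close> itself; that case is covered by \<open>c < h a\<close>.\<close>

lemma lsc_fun_eventually_less: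
  fixes X :: "nat \<Rightarrow> 'a :: topological_space"
  assumes "lsc_fun h" "X \<longlonglongrightarrow> a" "c < h a"
  shows "eventually (\<lambda>n. c < h (X n)) sequentially"
proof -
  have "c < Liminf (at a) h" using assms by (auto simp: lsc_fun_def intro: less_le_trans)
  then have "eventually (\<lambda>z. c < h z) (at a)" by (rule less_LiminfD)
  with \<open>c < h a\<close> have "eventually (\<lambda>z. c < h z) (nhds a)"
    by (auto simp: eventually_at_filter elim!: eventually_mono)
  with \<open>X \<longlonglongrightarrow> a\<close> show ?thesis by (rule eventually_compose_filterlim[rotated])
qed

text \<open>Brings the KL property into the reals: the norm of a single Frechet subgradient bounds
  the distance to the limiting subdifferential, and the desingularization has derivative c (1-p)
  s^(-p). The constant is uniform in the nearby point, the subgradient and \<open>E\<close>.\<close>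

lemma KL_real_inequality:
  fixes Z :: "'a :: euclidean_space \<Rightarrow> ereal"
  assumes "KL_property_at Z w p" "0 \<le> p" "p < 1" "Z w = ereal l" "0 < C"
  shows "\<exists>\<eta>>0. \<exists>K>0. \<exists>U. open U \<and> w \<in> U \<and>
    (\<forall>w'\<in>U. \<forall>z u E. Z w' = ereal z \<and> l < z \<and> z < l + \<eta> \<and> u \<in> frechet_subdiff Z w' \<and> norm u \<le> C * E
       \<longrightarrow> (z - l) powr p \<le> K * E)"
proof -
  from assms(1) obtain \<eta> c U where *: "\<eta> > 0" "c > 0" "open U" "w \<in> U"
    and kl: "\<And>w'. w' \<in> U \<Longrightarrow> 0 < Z w' - Z w \<Longrightarrow> Z w' - Z w < ereal \<eta> \<Longrightarrow>
           1 \<le> ereal (deriv (desing c p) (real_of_ereal (Z w' - Z w))) * dist_origin (limiting_subdiff Z w')"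
    unfolding KL_property_at_def by blast
  have "(z - l) powr p \<le> c * (1 - p) * C * E"
    if "w' \<in> U" "Z w' = ereal z" "l < z" "z < l + \<eta>" "u \<in> frechet_subdiff Z w'" "norm u \<le> C * E"
    for w' z u E
  proof -
    define s where "s = z - l"
    have s: "0 < s" "s < \<eta>" using that by (auto simp: s_def)
    have "(desing c p has_real_derivative c * (1 - p) * s powr (- p)) (at s)"
      unfolding desing_def using s by (auto intro!: derivative_eq_intros)
    then have deriv: "deriv (desing c p) s = c * (1 - p) * s powr (- p)" by (rule DERIV_imp_deriv)
    have "1 \<le> ereal (c * (1 - p) * s powr (- p)) * dist_origin (limiting_subdiff Z w')"
      using kl[of w'] that(1,2) s by (simp add: assms(4) deriv flip: s_def)
    also have "\<dots> \<le> ereal (c * (1 - p) * s powr (- p)) * ereal (norm u)"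
      using that(5) frechet_subset_limiting * assms(3)
      by (intro ereal_mult_left_mono dist_origin_le) auto
    finally have "1 \<le> c * (1 - p) * s powr (- p) * norm u" by (simp add: one_ereal_def)
    also have "\<dots> \<le> c * (1 - p) * s powr (- p) * (C * E)"
      using that(6) * assms(3) by (intro mult_left_mono) auto
    finally have "s powr p * 1 \<le> s powr p * (c * (1 - p) * s powr (- p) * (C * E))"
      by (rule mult_left_mono) simp
    also have "\<dots> = (s powr p * s powr (- p)) * (c * (1 - p) * C * E)" by (simp only: mult_ac)
    also have "s powr p * s powr (- p) = 1" using s(1) by (simp flip: powr_add)
    finally show ?thesis by (simp add: s_def)
  qed
  note bound = this
  show ?thesis
  proof (rule exI[of _ \<eta>], intro conjI, rule *(1), rule exI[of _ "c * (1 - p) * C"], intro conjI)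
    show "0 < c * (1 - p) * C" using * assms by simp
    show "\<exists>U. open U \<and> w \<in> U \<and> (\<forall>w'\<in>U. \<forall>z u E. Z w' = ereal z \<and> l < z \<and> z < l + \<eta> \<and>
        u \<in> frechet_subdiff Z w' \<and> norm u \<le> C * E \<longrightarrow> (z - l) powr p \<le> c * (1 - p) * C * E)"
      using *(3,4) by (intro exI[of _ U] conjI ballI allI impI bound) (assumption | elim conjE)+
  qed
qed

section \<open>Gradients and averages of smooth functions\<close>

lemma gderiv_unique:
  fixes f :: "'a :: real_inner \<Rightarrow> real"
  assumes "GDERIV f z :> a" "GDERIV f z :> b"
  shows "a = b"
proof -
  have "(\<lambda>h. h \<bullet> a) = (\<lambda>h. h \<bullet> b)"
    using assms unfolding gderiv_def by (rule has_derivative_unique)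
  then have "(a - b) \<bullet> a = (a - b) \<bullet> b" by (rule fun_cong)
  then have "(a - b) \<bullet> (a - b) = 0" by (simp add: inner_diff_right)
  then show ?thesis by simp
qed

lemma gradient_eqI: "GDERIV f z :> a \<Longrightarrow> gradient f z = a"
  unfolding gradient_def by (rule the_equality) (auto intro: gderiv_unique)

text \<open>\<open>gradient\<close> is a definite description; existence comes from expanding the
  derivative in the orthonormal basis.\<close>

lemma GDERIV_gradient:
  fixes f :: "'a :: euclidean_space \<Rightarrow> real"
  assumes "f differentiable (at z)"
  shows "GDERIV f z :> gradient f z"
proof -
  from assms obtain f' where f': "(f has_derivative f') (at z)" unfolding differentiable_def by blast
  define a where "a = (\<Sum>b\<in>Basis. f' b *\<^sub>R b)"
  have "f' h = h \<bullet> a" for h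
  proof -
    interpret linear f' using f' by (rule has_derivative_linear)
    have "f' h = f' (\<Sum>b\<in>Basis. (h \<bullet> b) *\<^sub>R b)" by (simp add: euclidean_representation)
    also have "\<dots> = h \<bullet> a" by (simp add: sum scale a_def inner_sum_right mult.commute)
    finally show ?thesis .
  qed
  then have "f' = (\<lambda>h. h \<bullet> a)" by (rule ext)
  with f' have "GDERIV f z :> a" by (simp add: gderiv_def)
  then show ?thesis using gradient_eqI by blast
qed

lemma finite_avg_smooth:
  fixes fs :: "nat \<Rightarrow> 'a :: euclidean_space \<Rightarrow> real"
  assumes "N \<ge> 1" and smooth: "\<And>j. j \<in> {1..N} \<Longrightarrow> L_smooth L (fs j)"
  shows "GDERIV (finite_avg N fs) z :> gradient (finite_avg N fs) z"
    and "norm (gradient (finite_avg N fs) z - gradient (finite_avg N fs) z') \<le> L * norm (z - z')"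
proof -
  have deriv: "GDERIV (finite_avg N fs) z :> (1 / real N) *\<^sub>R (\<Sum>j=1..N. gradient (fs j) z)" for z
  proof -
    have "(fs j has_derivative (\<lambda>h. h \<bullet> gradient (fs j) z)) (at z)" if "j \<in> {1..N}" for j
      using GDERIV_gradient smooth[OF that] unfolding L_smooth_def gderiv_def by blast
    then have "((\<lambda>z. (1 / real N) * (\<Sum>j=1..N. fs j z)) has_derivative
        (\<lambda>h. (1 / real N) * (\<Sum>j=1..N. h \<bullet> gradient (fs j) z))) (at z)"
      by (intro has_derivative_mult_right has_derivative_sum)
    then show ?thesis
      by (simp add: gderiv_def finite_avg_def[abs_def] inner_sum_right)
  qed
  then show "GDERIV (finite_avg N fs) z :> gradient (finite_avg N fs) z"
    using gradient_eqI by metis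
  have "gradient (finite_avg N fs) z - gradient (finite_avg N fs) z'
      = (1 / real N) *\<^sub>R (\<Sum>j=1..N. gradient (fs j) z - gradient (fs j) z')"
    by (simp add: gradient_eqI[OF deriv] sum_subtractf scaleR_diff_right)
  also have "norm \<dots> \<le> (1 / real N) * (\<Sum>j=1..N. L * norm (z - z'))"
    using smooth unfolding norm_scaleR L_smooth_def
    by (intro mult_mono order_trans[OF norm_sum] sum_mono) auto
  also have "\<dots> = L * norm (z - z')" using \<open>N \<ge> 1\<close> by simp
  finally show "norm (gradient (finite_avg N fs) z - gradient (finite_avg N fs) z') \<le> L * norm (z - z')" .
qed

section \<open>Iterates of the algorithm\<close>

text \<open>The averaging over components is left outside: \<open>f\<close> is any function with
  Lipschitz gradient. \<open>B\<close> is the radius of a ball containing the domain of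
  \<open>h\<close>, and \<open>tstar\<close> has the constants written out.\<close>

locale aepg =
  fixes f :: "real ^ 'n \<Rightarrow> real" and h :: "real ^ 'n \<Rightarrow> ereal"
    and L B v0 \<alpha> \<beta> \<theta> :: real and xbar :: "real ^ 'n"
    and x y v :: "nat \<Rightarrow> real ^ 'n" and \<sigma> :: "nat \<Rightarrow> real"
  assumes f_grad: "GDERIV f z :> gradient f z"
    and f_lip: "norm (gradient f z - gradient f z') \<le> L * norm (z - z')"
    and h_not_MInf: "h z \<noteq> -\<infinity>"
    and h_lsc: "lsc_fun h"
    and h_dom: "h z < \<infinity> \<Longrightarrow> norm z \<le> B"
    and xbar_fin: "h xbar < \<infinity>"
    and xbar_min: "ereal (f xbar) + h xbar \<le> ereal (f z) + h z"
    and params: "v0 > 0" "\<alpha> > 0" "\<beta> \<ge> 0" "0 \<le> \<theta>" "\<theta> < 1"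
    and algorithm: "AEPG f h v0 \<alpha> \<beta> \<theta> x y v \<sigma>"
    and tstar: "\<exists>ts. 1/2 * ((1 - \<theta>) / (1 + sqrt (\<beta> / \<alpha>)))\<^sup>2 * vmin (v ts) - 3 * L / 2 > 0"
begin

section \<open>Weights and extrapolation coefficients\<close>

lemma algorithm_simps:
  "v 0 = v0 *\<^sub>R 1" "y 0 = x 0" "\<sigma> 0 = \<theta>"
  "x (Suc t) \<in> Prox h (y t - vdiv (gradient f (y t)) (v t)) (v t)"
  "v (Suc t) = vsqrt (v 0 * v 0 + (\<Sum>i\<le>t. AEPG_s \<alpha> \<beta> x v i))"
  "\<sigma> (Suc t) = \<theta> * (1 - \<sigma> t) * vmin (vdiv (v t) (v (Suc t)))"
  "y (Suc t) = x (Suc t) + \<sigma> (Suc t) *\<^sub>R AEPG_d x t"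
  using algorithm by (auto simp: AEPG_def)

lemma L_nonneg: "0 \<le> L"
proof -
  have "0 \<le> L * norm (1 - 0 :: real ^ 'n)"
    using f_lip[of 1 0] norm_ge_zero order_trans by blast
  then show ?thesis by (simp add: zero_le_mult_iff)
qed

lemma AEPG_s_nth:
  "AEPG_s \<alpha> \<beta> x v t $ i = \<alpha> * (norm (AEPG_r x v t))\<^sup>2 + \<beta> * (AEPG_r x v t $ i)\<^sup>2"
  by (simp add: AEPG_s_def power2_eq_square)

lemma AEPG_s_nonneg: "0 \<le> AEPG_s \<alpha> \<beta> x v t $ i"
  using params by (simp add: AEPG_s_nth)

lemma v_nth: "v t $ i = sqrt (v0\<^sup>2 + (\<Sum>k<t. AEPG_s \<alpha> \<beta> x v k $ i))"
  using params(1)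
  by (cases t) (simp_all add: algorithm_simps(1,5) vsqrt_def power2_eq_square lessThan_Suc_atMost)

lemma v_nth_sq_Suc: "(v (Suc t) $ i)\<^sup>2 = (v t $ i)\<^sup>2 + AEPG_s \<alpha> \<beta> x v t $ i"
  using AEPG_s_nonneg by (simp add: v_nth sum_nonneg)

lemma v_ge: "v0 \<le> v t $ i"
  unfolding v_nth using AEPG_s_nonneg by (intro real_le_rsqrt) (simp add: sum_nonneg)

lemma v_pos: "0 < v t $ i"
  using v_ge[of t i] params(1) by linarith

lemma v_mono: "s \<le> t \<Longrightarrow> v s $ i \<le> v t $ i"
  unfolding v_nth using AEPG_s_nonneg by (intro real_sqrt_le_mono add_left_mono sum_mono2) auto

lemma vmin_ratio: "0 \<le> vmin (vdiv (v t) (v (Suc t)))" "vmin (vdiv (v t) (v (Suc t))) \<le> 1"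
proof -
  obtain i where "vmin (vdiv (v t) (v (Suc t))) = v t $ i / v (Suc t) $ i"
    using vmin_mem[of "vdiv (v t) (v (Suc t))"] by (auto simp: vdiv_def)
  then show "0 \<le> vmin (vdiv (v t) (v (Suc t)))" "vmin (vdiv (v t) (v (Suc t))) \<le> 1"
    using v_pos[of t i] v_pos[of "Suc t" i] v_mono[of t "Suc t" i] by auto
qed

lemma sigma_bounds: "0 \<le> \<sigma> t" "\<sigma> t \<le> \<theta>"
proof -
  have "0 \<le> \<sigma> t \<and> \<sigma> t \<le> \<theta>"
  proof (induction t)
    case (Suc t)
    then have 1: "0 \<le> 1 - \<sigma> t" "1 - \<sigma> t \<le> 1" using params by auto
    then have "(1 - \<sigma> t) * vmin (vdiv (v t) (v (Suc t))) \<le> 1"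
      using vmin_ratio[of t] by (intro mult_le_one) auto
    then have "\<theta> * ((1 - \<sigma> t) * vmin (vdiv (v t) (v (Suc t)))) \<le> \<theta> * 1"
      using params by (intro mult_left_mono) auto
    moreover have "0 \<le> \<theta> * ((1 - \<sigma> t) * vmin (vdiv (v t) (v (Suc t))))"
      using 1 vmin_ratio[of t] params by (intro mult_nonneg_nonneg) auto
    ultimately show ?case by (simp add: algorithm_simps(6) mult.assoc)
  qed (use algorithm_simps params in auto)
  then show "0 \<le> \<sigma> t" "\<sigma> t \<le> \<theta>" by auto
qed

text \<open>The purpose of the minimal ratio in \<open>\<sigma>\<close>: in every coordinate, the
  next momentum weight is paid for by the part 1 - \<sigma> of the current weight.\<close>

lemma sigma_v_le: "\<sigma> (Suc t) * v (Suc t) $ i \<le> \<theta> * (1 - \<sigma> t) * v t $ i"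
proof -
  have "vmin (vdiv (v t) (v (Suc t))) \<le> v t $ i / v (Suc t) $ i"
    using vmin_le[of "vdiv (v t) (v (Suc t))" i] by (simp add: vdiv_def)
  then have "vmin (vdiv (v t) (v (Suc t))) * v (Suc t) $ i \<le> v t $ i"
    using v_pos[of "Suc t" i] by (simp add: field_simps)
  then have "\<theta> * (1 - \<sigma> t) * (vmin (vdiv (v t) (v (Suc t))) * v (Suc t) $ i) \<le> \<theta> * (1 - \<sigma> t) * v t $ i"
    using sigma_bounds[of t] params by (intro mult_left_mono) auto
  then show ?thesis by (simp add: algorithm_simps(6) mult.assoc)
qed

section \<open>Descent of the Lyapunov values\<close>

text \<open>Completing the square turns the proximal objective into \<open>h\<close> plus a
  linear-quadratic model at \<open>y t\<close>, up to a finite constant that cancels.\<close>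

lemma prox_ineq:
  "h (x (Suc t)) + ereal (gradient f (y t) \<bullet> (x (Suc t) - y t) + wnorm2 (v t) (x (Suc t) - y t) / 2)
     \<le> h z + ereal (gradient f (y t) \<bullet> (z - y t) + wnorm2 (v t) (z - y t) / 2)"
proof -
  define g where "g = gradient f (y t)"
  define q where "q z = g \<bullet> (z - y t) + wnorm2 (v t) (z - y t) / 2" for z
  define c where "c = (\<Sum>i\<in>UNIV. (g $ i)\<^sup>2 / v t $ i) / 2"
  have complete_square: "1/2 * wnorm2 (v t) (z - (y t - vdiv g (v t))) = q z + c" for z
  proof -
    have "(a + b / w)\<^sup>2 * w / 2 = b * a + a\<^sup>2 * w / 2 + b\<^sup>2 / w / 2" if "w > 0" for a b w :: real
      using that by (simp add: power2_eq_square field_simps)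
    from this[OF v_pos[of t], of "(z - y t) $ i" "g $ i" for i]
    have sq: "((z - (y t - vdiv g (v t))) $ i)\<^sup>2 * v t $ i / 2
        = g $ i * (z - y t) $ i + ((z - y t) $ i)\<^sup>2 * v t $ i / 2 + (g $ i)\<^sup>2 / v t $ i / 2" for i
      by (simp add: vdiv_def diff_diff_eq2 add_diff_eq add_diff_eq diff_add_eq)
    have "1/2 * wnorm2 (v t) (z - (y t - vdiv g (v t)))
        = (\<Sum>i\<in>UNIV. g $ i * (z - y t) $ i + ((z - y t) $ i)\<^sup>2 * v t $ i / 2 + (g $ i)\<^sup>2 / v t $ i / 2)"
      unfolding wnorm2_def sum_distrib_left sq[symmetric] by simp
    then show ?thesis
      by (simp add: q_def c_def wnorm2_def inner_vec_def sum.distrib sum_divide_distrib)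
  qed
  have "h (x (Suc t)) + ereal (q (x (Suc t)) + c) \<le> h z + ereal (q z + c)"
    using algorithm_simps(4)[of t]
    unfolding Prox_def is_argmin_def is_arg_min_def g_def[symmetric] complete_square
    by (auto simp: not_less)
  then have "h (x (Suc t)) + ereal (q (x (Suc t))) \<le> h z + ereal (q z)"
    by (cases "h z"; cases "h (x (Suc t))") (auto simp: h_not_MInf)
  then show ?thesis by (simp add: q_def g_def)
qed

lemma h_x_finite: "h (x (Suc t)) < \<infinity>"
  using prox_ineq[of t xbar] xbar_fin by (cases "h (x (Suc t))") auto

text \<open>Real-valued stand-in for \<open>h\<close>: it agrees with \<open>h\<close> on the domain
  and has the default value 0 outside.\<close>

definition H where "H z = real_of_ereal (h z)"

lemma h_eq_H: "h z < \<infinity> \<Longrightarrow> h z = ereal (H z)"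
  unfolding H_def using h_not_MInf[of z] by (cases "h z") auto

lemma h_x: "0 < t \<Longrightarrow> h (x t) = ereal (H (x t))"
  using h_eq_H h_x_finite by (cases t) auto

text \<open>The initial point need not lie in the domain of \<open>h\<close>, so \<open>lyap 0\<close> may be a junk value.\<close>

definition lyap where
  "lyap t = f (x t) + H (x t) - (f xbar + H xbar) + wnorm2 (\<sigma> t *\<^sub>R (v t + L *\<^sub>R 1)) (x t - x (t - 1)) / 2"

lemma y_eq: "y t = x t + \<sigma> t *\<^sub>R (x t - x (t - 1))"
  by (cases t) (auto simp: algorithm_simps AEPG_d_def)

lemma lyap_nonneg: assumes "0 < t" shows "0 \<le> lyap t"
proof -
  have "f xbar + H xbar \<le> f (x t) + H (x t)"
    using xbar_min[of "x t"] h_eq_H[OF xbar_fin] h_x[OF assms] by simp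
  moreover have "0 \<le> wnorm2 (\<sigma> t *\<^sub>R (v t + L *\<^sub>R 1)) (x t - x (t - 1))"
    using sigma_bounds[of t] L_nonneg v_pos[of t] by (intro wnorm2_nonneg) (simp add: less_imp_le)
  ultimately show ?thesis by (simp add: lyap_def)
qed

text \<open>Three estimates add up: minimality of the proximal point tested against
  \<open>x t\<close>, the descent inequality for \<open>f\<close>, and the mismatch of the gradients
  at \<open>x t\<close> and \<open>y t\<close>. The sum splits into coordinates. Positivity of t
  puts \<open>x t\<close> into the domain of \<open>h\<close>.\<close>

lemma lyap_step:
  assumes "0 < t"
  shows "lyap (Suc t) - lyap t \<le> - ((1 - \<theta>)\<^sup>2 / 2 * vmin (v t) - 3 * L / 2) * (norm (x (Suc t) - x t))\<^sup>2"
proof -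
  define d where "d = x (Suc t) - x t"
  define e where "e = x t - x (t - 1)"
  define g where "g = gradient f (y t)"
  have y: "y t = x t + \<sigma> t *\<^sub>R e" by (simp add: y_eq e_def)
  have diffs: "x (Suc t) - y t = d - \<sigma> t *\<^sub>R e" "x t - y t = - (\<sigma> t *\<^sub>R e)"
    by (auto simp: y d_def)
  have s: "0 \<le> \<sigma> t" "\<sigma> t \<le> \<theta>" "0 \<le> \<sigma> (Suc t)" "\<sigma> (Suc t) \<le> \<theta>" using sigma_bounds by auto
  have "H (x (Suc t)) + (g \<bullet> (d - \<sigma> t *\<^sub>R e) + wnorm2 (v t) (d - \<sigma> t *\<^sub>R e) / 2)
      \<le> H (x t) + (g \<bullet> (- (\<sigma> t *\<^sub>R e)) + wnorm2 (v t) (- (\<sigma> t *\<^sub>R e)) / 2)"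
    using prox_ineq[of t "x t"] by (simp add: h_x assms diffs flip: g_def)
  then have 1: "H (x (Suc t)) - H (x t) \<le> - (g \<bullet> d) + (wnorm2 (v t) (- (\<sigma> t *\<^sub>R e)) - wnorm2 (v t) (d - \<sigma> t *\<^sub>R e)) / 2"
    by (simp add: inner_diff diff_divide_distrib)
  have 2: "f (x (Suc t)) - f (x t) \<le> gradient f (x t) \<bullet> d + L / 2 * (norm d)\<^sup>2"
    using descent_inequality[of f "gradient f" L "x (Suc t)" "x t", OF f_grad f_lip] by (simp add: d_def)
  \<comment> \<open>The proximal step uses the gradient at \<open>y t\<close>, at distance \<sigma>
    |e| from \<open>x t\<close>. The resulting multiple of |e|^2 is exactly offset by the L part of
    the weight in \<open>lyap t\<close>.\<close>
  have 3: "gradient f (x t) \<bullet> d - g \<bullet> d \<le> L * \<sigma> t / 2 * ((norm e)\<^sup>2 + (norm d)\<^sup>2)"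
  proof -
    have "gradient f (x t) \<bullet> d - g \<bullet> d \<le> norm (gradient f (x t) - g) * norm d"
      unfolding inner_diff_left[symmetric] by (rule norm_cauchy_schwarz)
    also have "\<dots> \<le> (L * norm (x t - y t)) * norm d"
      unfolding g_def by (intro mult_right_mono f_lip) auto
    also have "\<dots> = L * \<sigma> t / 2 * (2 * norm e * norm d)"
      using s by (simp add: diffs)
    also have "\<dots> \<le> L * \<sigma> t / 2 * ((norm e)\<^sup>2 + (norm d)\<^sup>2)"
      using s L_nonneg by (intro mult_left_mono two_mult_le_squares) auto
    finally show ?thesis .
  qed
  have "lyap (Suc t) - lyap t = (f (x (Suc t)) - f (x t)) + (H (x (Suc t)) - H (x t))
      + wnorm2 (\<sigma> (Suc t) *\<^sub>R (v (Suc t) + L *\<^sub>R 1)) d / 2 - wnorm2 (\<sigma> t *\<^sub>R (v t + L *\<^sub>R 1)) e / 2"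
    by (simp add: lyap_def d_def e_def)
  also have "\<dots> \<le> L * \<sigma> t / 2 * ((norm e)\<^sup>2 + (norm d)\<^sup>2) + L / 2 * (norm d)\<^sup>2
      + (wnorm2 (v t) (- (\<sigma> t *\<^sub>R e)) - wnorm2 (v t) (d - \<sigma> t *\<^sub>R e)) / 2
      + wnorm2 (\<sigma> (Suc t) *\<^sub>R (v (Suc t) + L *\<^sub>R 1)) d / 2 - wnorm2 (\<sigma> t *\<^sub>R (v t + L *\<^sub>R 1)) e / 2"
    using 1 2 3 by argo
  also have "\<dots> = (\<Sum>i\<in>UNIV. L * \<sigma> t / 2 * ((e $ i)\<^sup>2 + (d $ i)\<^sup>2) + L / 2 * (d $ i)\<^sup>2
      + ((- (\<sigma> t * e $ i))\<^sup>2 * v t $ i - (d $ i - \<sigma> t * e $ i)\<^sup>2 * v t $ i) / 2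
      + (d $ i)\<^sup>2 * (\<sigma> (Suc t) * (v (Suc t) $ i + L)) / 2 - (e $ i)\<^sup>2 * (\<sigma> t * (v t $ i + L)) / 2)"
    unfolding norm_sq_vec wnorm2_def
    by (simp add: sum.distrib sum_subtractf flip: sum_divide_distrib sum_distrib_left)
  also have "\<dots> \<le> (\<Sum>i\<in>UNIV. - ((1 - \<theta>)\<^sup>2 / 2 * vmin (v t) - 3 * L / 2) * (d $ i)\<^sup>2)"
  proof (rule sum_mono)
    fix i
    let ?d = "d $ i" and ?e = "e $ i" and ?v = "v t $ i"
    let ?lhs = "L * \<sigma> t / 2 * (?e\<^sup>2 + ?d\<^sup>2) + L / 2 * ?d\<^sup>2
      + ((- (\<sigma> t * ?e))\<^sup>2 * ?v - (?d - \<sigma> t * ?e)\<^sup>2 * ?v) / 2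
      + ?d\<^sup>2 * (\<sigma> (Suc t) * (v (Suc t) $ i + L)) / 2 - ?e\<^sup>2 * (\<sigma> t * (?v + L)) / 2"
    let ?rhs = "- ((1 - \<theta>)\<^sup>2 / 2 * vmin (v t) - 3 * L / 2) * ?d\<^sup>2"
    have a: "\<sigma> t * ?v * (2 * ?d * ?e) \<le> \<sigma> t * ?v * (?d\<^sup>2 + ?e\<^sup>2)"
      using s v_pos[of t i] by (intro mult_left_mono two_mult_le_squares) auto
    have b: "?d\<^sup>2 * (\<sigma> (Suc t) * v (Suc t) $ i) \<le> ?d\<^sup>2 * (\<theta> * (1 - \<sigma> t) * ?v)"
      using sigma_v_le by (intro mult_left_mono) auto
    have c: "?d\<^sup>2 * (L * (\<sigma> t + \<sigma> (Suc t))) \<le> ?d\<^sup>2 * (L * 2)"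
      using s params L_nonneg by (intro mult_left_mono) auto
    have "(1 - \<theta>) * (1 - \<theta>) * vmin (v t) \<le> (1 - \<theta>) * (1 - \<sigma> t) * ?v"
    proof -
      have "(1 - \<theta>) * (1 - \<theta>) * vmin (v t) \<le> (1 - \<theta>) * (1 - \<theta>) * ?v"
        by (intro mult_left_mono vmin_le) auto
      also have "\<dots> \<le> (1 - \<theta>) * (1 - \<sigma> t) * ?v"
        using s params v_pos[of t i] by (intro mult_right_mono mult_left_mono) auto
      finally show ?thesis .
    qed
    then have e: "?d\<^sup>2 * ((1 - \<theta>) * (1 - \<theta>) * vmin (v t)) \<le> ?d\<^sup>2 * ((1 - \<theta>) * (1 - \<sigma> t) * ?v)"
      by (intro mult_left_mono) auto
    \<comment> \<open>The difference is half of four nonpositive slacks: the cross term, the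
      momentum weight, the L terms, and the passage from the coordinate weight to
      \<open>vmin\<close>.\<close>
    have "?lhs - ?rhs
      = ((\<sigma> t * ?v * (2 * ?d * ?e) - \<sigma> t * ?v * (?d\<^sup>2 + ?e\<^sup>2))
        + (?d\<^sup>2 * (\<sigma> (Suc t) * v (Suc t) $ i) - ?d\<^sup>2 * (\<theta> * (1 - \<sigma> t) * ?v))
        + (?d\<^sup>2 * (L * (\<sigma> t + \<sigma> (Suc t))) - ?d\<^sup>2 * (L * 2))
        + (?d\<^sup>2 * ((1 - \<theta>) * (1 - \<theta>) * vmin (v t)) - ?d\<^sup>2 * ((1 - \<theta>) * (1 - \<sigma> t) * ?v))) / 2"
      by (simp add: power2_eq_square field_simps)
    also have "\<dots> \<le> 0"
      using a b c e by (intro divide_nonpos_pos add_nonpos_nonpos)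
        (simp_all only: diff_le_0_iff_le zero_less_numeral)
    finally show "?lhs \<le> ?rhs" by (simp only: diff_le_0_iff_le)
  qed
  also have "\<dots> = - ((1 - \<theta>)\<^sup>2 / 2 * vmin (v t) - 3 * L / 2) * (norm d)\<^sup>2"
    unfolding norm_sq_vec sum_distrib_left ..
  finally show ?thesis by (simp add: d_def)
qed

lemma sufficient_descent:
  "\<exists>T>0. \<exists>\<xi>>0. \<forall>t\<ge>T. \<xi> * (norm (x (Suc t) - x t))\<^sup>2 \<le> lyap t - lyap (Suc t)"
proof -
  from tstar obtain ts
    where "1/2 * ((1 - \<theta>) / (1 + sqrt (\<beta> / \<alpha>)))\<^sup>2 * vmin (v ts) - 3 * L / 2 > 0" by blast
  \<comment> \<open>Since \<kappa> \<ge> 1, removing it only enlarges the coefficient.\<close>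
  moreover have "1/2 * ((1 - \<theta>) / (1 + sqrt (\<beta> / \<alpha>)))\<^sup>2 * vmin (v ts) \<le> 1/2 * (1 - \<theta>)\<^sup>2 * vmin (v ts)"
  proof (intro mult_right_mono mult_left_mono power_mono)
    have "1 - \<theta> \<le> (1 - \<theta>) * (1 + sqrt (\<beta> / \<alpha>))" using params by simp
    moreover have "1 + sqrt (\<beta> / \<alpha>) > 0" using params by (simp add: add_pos_nonneg)
    ultimately show "(1 - \<theta>) / (1 + sqrt (\<beta> / \<alpha>)) \<le> 1 - \<theta>" by (simp add: divide_le_eq)
    show "0 \<le> (1 - \<theta>) / (1 + sqrt (\<beta> / \<alpha>))" using params by simp
    show "0 \<le> vmin (v ts)" using vmin_mem[of "v ts"] v_pos[of ts] by (metis less_imp_le)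
  qed simp
  ultimately have ts: "3 * L / 2 < (1 - \<theta>)\<^sup>2 / 2 * vmin (v ts)" by simp
  define \<xi> where "\<xi> = (1 - \<theta>)\<^sup>2 / 2 * vmin (v ts) - 3 * L / 2"
  \<comment> \<open>Monotone weights carry the positive coefficient from \<open>ts\<close> to all
    later indices; starting at \<open>Suc ts\<close> makes the index positive, as
    \<open>lyap_step\<close> requires.\<close>
  have "\<xi> * (norm (x (Suc t) - x t))\<^sup>2 \<le> lyap t - lyap (Suc t)" if t: "t \<ge> Suc ts" for t
  proof -
    have "vmin (v ts) \<le> vmin (v t)"
      using vmin_mem[of "v t"] vmin_le[of "v ts"] v_mono[of ts t] t
      by (metis Suc_leD order_trans)
    then have "\<xi> \<le> (1 - \<theta>)\<^sup>2 / 2 * vmin (v t) - 3 * L / 2"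
      unfolding \<xi>_def by (intro diff_right_mono mult_left_mono) auto
    then have "\<xi> * (norm (x (Suc t) - x t))\<^sup>2 \<le> ((1 - \<theta>)\<^sup>2 / 2 * vmin (v t) - 3 * L / 2) * (norm (x (Suc t) - x t))\<^sup>2"
      by (intro mult_right_mono) auto
    with lyap_step[of t] t show ?thesis by (simp add: algebra_simps)
  qed
  moreover have "\<xi> > 0" using ts by (simp add: \<xi>_def)
  ultimately show ?thesis by (intro exI[of _ "Suc ts"]) auto
qed

section \<open>Square-summable steps and limits of the weights\<close>

lemma summable_steps_sq: "summable (\<lambda>t. (norm (x (Suc t) - x t))\<^sup>2)"
proof -
  obtain T \<xi> where T: "T > 0" "\<xi> > 0"
    "\<And>t. t \<ge> T \<Longrightarrow> \<xi> * (norm (x (Suc t) - x t))\<^sup>2 \<le> lyap t - lyap (Suc t)"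
    using sufficient_descent by blast
  have "summable (\<lambda>t. \<xi> * (norm (x (Suc (t + T)) - x (t + T)))\<^sup>2)"
    using T lyap_nonneg
    by (intro telescope_summable(1)[where G = "\<lambda>t. lyap (t + T)"]) auto
  then have "summable (\<lambda>t. (norm (x (Suc (t + T)) - x (t + T)))\<^sup>2)"
    using T(2) by (simp add: summable_cmult_iff)
  then show ?thesis by (simp add: summable_iff_shift[of "\<lambda>t. (norm (x (Suc t) - x t))\<^sup>2"])
qed

lemma steps_tendsto_0: "(\<lambda>t. x (Suc t) - x t) \<longlonglongrightarrow> 0"
proof -
  have "(\<lambda>t. sqrt ((norm (x (Suc t) - x t))\<^sup>2)) \<longlonglongrightarrow> sqrt 0"
    by (intro tendsto_intros summable_LIMSEQ_zero summable_steps_sq)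
  then show ?thesis by (simp add: tendsto_norm_zero_iff)
qed

text \<open>Each step multiplies \<open>\<parallel>v\<^sup>t\<parallel>\<^sup>2\<close> by at most \<open>1 + C\<parallel>d\<^sup>t\<parallel>\<^sup>2\<close>, and the product of these factors
  converges.\<close>

lemma v_norm_bounded: "\<exists>V>0. \<forall>t. norm (v t) \<le> V"
proof -
  define C where "C = real CARD('n) * \<alpha> + \<beta>"
  define S where "S = (\<Sum>t. (norm (x (Suc t) - x t))\<^sup>2)"
  have C: "C \<ge> 0" using params by (simp add: C_def)
  have step: "(norm (v (Suc t)))\<^sup>2 \<le> (norm (v t))\<^sup>2 * (1 + C * (norm (x (Suc t) - x t))\<^sup>2)" for t
  proof -
    have "(norm (v (Suc t)))\<^sup>2 = (norm (v t))\<^sup>2 + C * (norm (AEPG_r x v t))\<^sup>2"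
      unfolding norm_sq_vec[of "v _"] v_nth_sq_Suc AEPG_s_nth
      by (simp add: sum.distrib C_def algebra_simps norm_sq_vec[of "AEPG_r x v t"]
               flip: sum_distrib_left)
    also have "(norm (AEPG_r x v t))\<^sup>2 \<le> (norm (v t) * norm (x (Suc t) - x t))\<^sup>2"
      unfolding AEPG_r_def AEPG_d_def by (intro power_mono norm_mult_vec_le) auto
    finally show ?thesis
      using mult_left_mono[OF _ C] by (simp add: algebra_simps power_mult_distrib)
  qed
  have "(norm (v t))\<^sup>2 \<le> (norm (v 0))\<^sup>2 * exp (C * (\<Sum>k<t. (norm (x (Suc k) - x k))\<^sup>2))" for t
  proof (induction t)
    case (Suc t)
    have "(norm (v (Suc t)))\<^sup>2 \<le> (norm (v t))\<^sup>2 * exp (C * (norm (x (Suc t) - x t))\<^sup>2)"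
      using step[of t] mult_left_mono[OF exp_ge_add_one_self, of "(norm (v t))\<^sup>2"]
      by (meson order_trans zero_le_power2)
    also have "\<dots> \<le> (norm (v 0))\<^sup>2 * exp (C * (\<Sum>k<t. (norm (x (Suc k) - x k))\<^sup>2))
        * exp (C * (norm (x (Suc t) - x t))\<^sup>2)"
      using Suc by (intro mult_right_mono) auto
    finally show ?case by (simp add: exp_add ring_distribs mult.assoc)
  qed simp
  also have "(norm (v 0))\<^sup>2 * exp (C * (\<Sum>k<t. (norm (x (Suc k) - x k))\<^sup>2)) \<le> (norm (v 0))\<^sup>2 * exp (C * S)" for t
    unfolding S_def using C
    by (intro mult_left_mono iffD2[OF exp_le_cancel_iff] sum_le_suminf summable_steps_sq) auto
  finally have "norm (v t) \<le> sqrt ((norm (v 0))\<^sup>2 * exp (C * S))" for t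
    by (intro real_le_rsqrt)
  then show ?thesis by (metis less_add_one less_le_not_le order_trans norm_ge_zero le_less_trans linorder_le_cases)
qed

lemma v_convergent: "convergent v"
proof -
  obtain V where V: "\<And>t. norm (v t) \<le> V" using v_norm_bounded by blast
  have "convergent (\<lambda>t. v t $ i)" for i
  proof (rule Bseq_mono_convergent)
    show "Bseq (\<lambda>t. v t $ i)"
      using V component_le_norm_cart order_trans by (intro BseqI'[of _ V]) (simp, blast)
  qed (use v_mono in auto)
  then have "(\<lambda>t. v t $ i) \<longlonglongrightarrow> (\<chi> i. lim (\<lambda>t. v t $ i)) $ i" for i
    by (simp add: convergent_LIMSEQ_iff)
  then show ?thesis by (intro convergentI) (rule vec_tendstoI)
qed

definition vinf where "vinf = lim v"

lemma v_LIMSEQ: "v \<longlonglongrightarrow> vinf"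
  using v_convergent by (simp add: vinf_def convergent_LIMSEQ_iff)

text \<open>Since \<open>s = \<theta> / (1 + \<theta>)\<close> is the fixed point of \<open>s \<mapsto> \<theta> (1 - s)\<close>, the distance \<open>\<bar>\<sigma>\<^sup>t - s\<bar>\<close>
  contracts by the factor \<open>\<theta>\<close> up to an error that telescopes along the weights.\<close>

lemma sigma_LIMSEQ: "\<sigma> \<longlonglongrightarrow> \<theta> / (1 + \<theta>)"
proof -
  define s where "s = \<theta> / (1 + \<theta>)"
  have s: "\<theta> * (1 - s) = s" "0 \<le> s" using params by (auto simp: s_def field_simps)
  \<comment> \<open>The second summand is the growth the weights still have ahead, scaled by 1 /
    \<open>v0\<close>. Its decrease in one step dominates the deviation of the minimal ratio from
    1.\<close>
  define G where "G t = \<bar>\<sigma> t - s\<bar> + (\<Sum>i\<in>UNIV. (vinf $ i - v t $ i) / v0)" for t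
  have v_le: "v t $ i \<le> vinf $ i" for t i
    using v_mono by (intro incseq_le tendsto_vec_nth[OF v_LIMSEQ]) (auto simp: incseq_def)
  have step: "(1 - \<theta>) * \<bar>\<sigma> t - s\<bar> \<le> G t - G (Suc t)" for t
  proof -
    define m where "m = vmin (vdiv (v t) (v (Suc t)))"
    have m: "0 \<le> m" "m \<le> 1" using vmin_ratio by (auto simp: m_def)
    obtain j where j: "m = v t $ j / v (Suc t) $ j"
      using vmin_mem[of "vdiv (v t) (v (Suc t))"] by (auto simp: m_def vdiv_def)
    have "1 - m = (v (Suc t) $ j - v t $ j) / v (Suc t) $ j"
      using v_pos[of "Suc t" j] by (simp add: j diff_divide_distrib)
    also have "\<dots> \<le> (v (Suc t) $ j - v t $ j) / v0"
      using v_ge[of "Suc t" j] v_mono[of t "Suc t" j] params by (intro divide_left_mono) auto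
    also have "\<dots> \<le> (\<Sum>i\<in>UNIV. (v (Suc t) $ i - v t $ i) / v0)"
      using v_mono[of t "Suc t"] params by (intro member_le_sum) auto
    finally have m1: "1 - m \<le> (\<Sum>i\<in>UNIV. (v (Suc t) $ i - v t $ i) / v0)" .
    have "\<sigma> (Suc t) - s = \<theta> * m * (s - \<sigma> t) - s * (1 - m)"
    proof -
      have "\<sigma> (Suc t) - s = \<theta> * (1 - \<sigma> t) * m - s * m - s * (1 - m)"
        by (simp add: algorithm_simps(6) m_def algebra_simps)
      \<comment> \<open>The fixed point equation lets the first two terms combine into a multiple of
        \<open>s - \<sigma> t\<close>.\<close>
      also have "s * m = \<theta> * (1 - s) * m" by (simp only: s(1))
      finally have "\<sigma> (Suc t) - s = \<theta> * (1 - \<sigma> t) * m - \<theta> * (1 - s) * m - s * (1 - m)" .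
      then show ?thesis by (simp add: algebra_simps)
    qed
    then have "\<bar>\<sigma> (Suc t) - s\<bar> \<le> \<theta> * m * \<bar>\<sigma> t - s\<bar> + s * (1 - m)"
      using abs_triangle_ineq4[of "\<theta> * m * (s - \<sigma> t)" "s * (1 - m)"] m s params
      by (simp add: abs_mult abs_minus_commute)
    also have "\<dots> \<le> \<theta> * 1 * \<bar>\<sigma> t - s\<bar> + 1 * (1 - m)"
      using m params by (intro add_mono mult_right_mono mult_left_mono) (auto simp: s_def)
    finally have "\<bar>\<sigma> (Suc t) - s\<bar> \<le> \<theta> * \<bar>\<sigma> t - s\<bar> + (\<Sum>i\<in>UNIV. (v (Suc t) $ i - v t $ i) / v0)"
      using m1 by simp
    moreover have "(\<Sum>i\<in>UNIV. (v (Suc t) $ i - v t $ i) / v0)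
        = (\<Sum>i\<in>UNIV. (vinf $ i - v t $ i) / v0) - (\<Sum>i\<in>UNIV. (vinf $ i - v (Suc t) $ i) / v0)"
      by (simp add: diff_divide_distrib flip: sum_subtractf)
    ultimately show ?thesis by (simp add: G_def algebra_simps)
  qed
  have "summable (\<lambda>t. (1 - \<theta>) * \<bar>\<sigma> t - s\<bar>)"
    using v_le params step
    by (intro telescope_summable(1)[where G = G]) (auto simp: G_def intro!: add_nonneg_nonneg sum_nonneg)
  then have "summable (\<lambda>t. \<bar>\<sigma> t - s\<bar>)"
    using params by (simp add: summable_cmult_iff)
  then have "(\<lambda>t. \<sigma> t - s) \<longlonglongrightarrow> 0"
    using summable_LIMSEQ_zero tendsto_rabs_zero_iff by blast
  then show ?thesis unfolding s_def by (simp add: LIM_zero_iff)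
qed

section \<open>Subgradients of \<open>Z\<close> at the iterates\<close>

definition obj where "obj z = ereal (f z) + h z"

definition dx where "dx t = norm (x (Suc t) - x t)"

abbreviation "Z \<equiv> KL_Z obj xbar L"
abbreviation "W \<equiv> AEPG_W x v \<sigma>"

lemma obj_eq: "h z < \<infinity> \<Longrightarrow> obj z = ereal (f z + H z)"
  by (simp add: obj_def h_eq_H)

lemma Z_eq:
  "h a < \<infinity> \<Longrightarrow> Z (a, b, s, w)
     = ereal (f a + H a - (f xbar + H xbar) + wnorm2 (s *\<^sub>R (w + L *\<^sub>R 1)) (a - b) / 2)"
  by (simp add: KL_Z_def obj_eq[OF xbar_fin] obj_eq)

lemma Z_W: "0 < t \<Longrightarrow> Z (W t) = ereal (lyap t)"
  using h_x_finite[of "t - 1"] by (simp add: AEPG_W_def Z_eq lyap_def)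

text \<open>The components are the partial derivatives in x, x', \<sigma> and v. In the first one,
  \<open>- gradient f (y t) - v t * (x (Suc t) - y t)\<close> is the subgradient of \<open>h\<close>
  supplied by proximal optimality.\<close>

definition subgrad :: "nat \<Rightarrow> (real ^ 'n) \<times> (real ^ 'n) \<times> real \<times> (real ^ 'n)" where
  "subgrad t =
    (let d = x (Suc t) - x t; s = \<sigma> (Suc t); w = v (Suc t) + L *\<^sub>R 1 in
     (gradient f (x (Suc t)) - gradient f (y t) - v t * (x (Suc t) - y t) + s *\<^sub>R (w * d),
      - (s *\<^sub>R (w * d)), wnorm2 w d / 2, (s / 2) *\<^sub>R (d * d)))"

text \<open>The optimality of \<open>x\<^sup>t\<^sup>+\<^sup>1\<close> in the proximal step says that \<open>h\<close> is minorized by a quadratic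
  touching it at \<open>x\<^sup>t\<^sup>+\<^sup>1\<close>.\<close>

lemma subgrad_frechet: "subgrad t \<in> frechet_subdiff Z (W (Suc t))"
proof -
  define q where "q z = gradient f (y t) \<bullet> (z - y t) + wnorm2 (v t) (z - y t) / 2" for z
  define c where "c = H (x (Suc t)) + q (x (Suc t)) - (f xbar + H xbar)"
  \<comment> \<open>\<open>G\<close> is \<open>Z\<close> with \<open>h\<close> replaced by its
    minorant \<open>H (x (Suc t)) + q (x (Suc t)) - q\<close>; the constant \<open>c\<close> also
    carries the optimal value.\<close>
  define G :: "(real ^ 'n) \<times> (real ^ 'n) \<times> real \<times> (real ^ 'n) \<Rightarrow> real" where
    "G z = f (fst z) - q (fst z) + c
       + 1/2 * wnorm2 (fst (snd (snd z)) *\<^sub>R (snd (snd (snd z)) + L *\<^sub>R 1)) (fst z - fst (snd z))" for z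
  have GW: "G (W (Suc t)) = lyap (Suc t)"
    by (simp add: G_def AEPG_W_def lyap_def c_def)
  have eq: "Z (W (Suc t)) = ereal (G (W (Suc t)))"
    by (simp add: Z_W GW)
  have le: "ereal (G z) \<le> Z z" for z
  proof -
    obtain a b s w where z: "z = (a, b, s, w)" by (cases z) auto
    show ?thesis
    proof (cases "h a < \<infinity>")
      case True
      have "H (x (Suc t)) + q (x (Suc t)) \<le> H a + q a"
        using prox_ineq[of t a] h_x[of "Suc t"] h_eq_H[OF True] by (simp add: q_def)
      then show ?thesis
        by (simp add: z Z_eq[OF True] G_def c_def)
    next
      case False
      then show ?thesis using obj_eq[OF xbar_fin] by (simp add: z KL_Z_def obj_def)
    qed
  qed
  have df: "((\<lambda>z. f (fst z)) has_derivative (\<lambda>d. fst d \<bullet> gradient f (x (Suc t)))) (at (W (Suc t)))"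
    by (rule has_derivative_compose[OF has_derivative_fst[OF has_derivative_ident]])
       (use f_grad[of "x (Suc t)"] in \<open>simp add: gderiv_def AEPG_W_def\<close>)
  have dq: "((\<lambda>z. q (fst z)) has_derivative
      (\<lambda>d. (gradient f (y t) + v t * (x (Suc t) - y t)) \<bullet> fst d)) (at (W (Suc t)))"
    unfolding q_def
    by (auto intro!: derivative_eq_intros simp: AEPG_W_def inner_add_left)
  define w where "w = v (Suc t) + L *\<^sub>R 1"
  define e where "e = x (Suc t) - x t"
  have dw: "((\<lambda>z. wnorm2 (fst (snd (snd z)) *\<^sub>R (snd (snd (snd z)) + L *\<^sub>R 1)) (fst z - fst (snd z))) has_derivative
      (\<lambda>d. (2 *\<^sub>R (\<sigma> (Suc t) *\<^sub>R w * e)) \<bullet> (fst d - fst (snd d))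
        + (e * e) \<bullet> (fst (snd (snd d)) *\<^sub>R w + \<sigma> (Suc t) *\<^sub>R snd (snd (snd d))))) (at (W (Suc t)))"
    by (rule wnorm2_has_derivative[THEN has_derivative_eq_rhs])
       (auto intro!: derivative_eq_intros simp: AEPG_W_def w_def e_def fun_eq_iff algebra_simps)
  have wee: "(e * e) \<bullet> w = wnorm2 w e"
    by (simp add: wnorm2_def inner_vec_def power2_eq_square)
  have "(G has_derivative (\<lambda>d. fst d \<bullet> gradient f (x (Suc t))
      - (gradient f (y t) + v t * (x (Suc t) - y t)) \<bullet> fst d + 0
      + 1/2 * ((2 *\<^sub>R (\<sigma> (Suc t) *\<^sub>R w * e)) \<bullet> (fst d - fst (snd d))
        + (e * e) \<bullet> (fst (snd (snd d)) *\<^sub>R w + \<sigma> (Suc t) *\<^sub>R snd (snd (snd d)))))) (at (W (Suc t)))"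
    unfolding G_def
    by (intro has_derivative_add has_derivative_diff has_derivative_const has_derivative_mult_right df dq dw)
  moreover have "(\<lambda>d. fst d \<bullet> gradient f (x (Suc t))
      - (gradient f (y t) + v t * (x (Suc t) - y t)) \<bullet> fst d + 0
      + 1/2 * ((2 *\<^sub>R (\<sigma> (Suc t) *\<^sub>R w * e)) \<bullet> (fst d - fst (snd d))
        + (e * e) \<bullet> (fst (snd (snd d)) *\<^sub>R w + \<sigma> (Suc t) *\<^sub>R snd (snd (snd d)))))
      = (\<lambda>d. subgrad t \<bullet> d)"
    unfolding subgrad_def Let_def w_def[symmetric] e_def[symmetric]
    by (simp add: fun_eq_iff inner_prod_def inner_add inner_diff inner_commute[of "gradient f (x (Suc t))"]
        wee field_simps)
  ultimately have "(G has_derivative (\<lambda>d. subgrad t \<bullet> d)) (at (W (Suc t)))" by simp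
  from frechet_subdiff_minorant[OF eq le this] show ?thesis .
qed

lemma x_Suc_minus_y: "x (Suc t) - y t = (x (Suc t) - x t) - \<sigma> t *\<^sub>R (x t - x (t - 1))"
  by (simp add: y_eq)

lemma norm_x_Suc_minus_y: "norm (x (Suc t) - y t) \<le> dx t + norm (x t - x (t - 1))"
proof -
  have "norm (\<sigma> t *\<^sub>R (x t - x (t - 1))) \<le> 1 * norm (x t - x (t - 1))"
    unfolding norm_scaleR using sigma_bounds[of t] params by (intro mult_right_mono) auto
  then show ?thesis
    unfolding x_Suc_minus_y dx_def
    using norm_triangle_ineq4[of "x (Suc t) - x t" "\<sigma> t *\<^sub>R (x t - x (t - 1))"] by simp
qed

lemma norm_x: "norm (x (Suc t)) \<le> B"
  using h_dom h_x_finite by blast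

text \<open>The x and x' components are of first order in the steps. The other two are quadratic and
  become linear by |d| \<le> 2 B; the shift to \<open>Suc t\<close> keeps both iterates in the
  bounded domain, which \<open>x 0\<close> may miss.\<close>

lemma subgrad_bound: "\<exists>C>0. \<forall>t. norm (subgrad (Suc t)) \<le> C * (dx (Suc t) + dx t)"
proof -
  obtain V where V: "V > 0" "\<And>t. norm (v t) \<le> V" using v_norm_bounded by blast
  define V1 where "V1 = V + L * norm (1 :: real ^ 'n)"
  define C where "C = L + V + V1 + V1 + V1 * B + B + 1"
  have V1: "norm (v t + L *\<^sub>R 1) \<le> V1" for t
    using norm_triangle_ineq[of "v t" "L *\<^sub>R 1"] V(2)[of t] L_nonneg by (simp add: V1_def)
  have V1_nonneg: "0 \<le> V1" using V1[of 0] norm_ge_zero order_trans by blast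
  have B: "0 \<le> B" using norm_x[of 0] norm_ge_zero order_trans by blast
  have "norm (subgrad (Suc t)) \<le> C * (dx (Suc t) + dx t)" for t
  proof -
    define d where "d = x (Suc (Suc t)) - x (Suc t)"
    define s where "s = \<sigma> (Suc (Suc t))"
    define w where "w = v (Suc (Suc t)) + L *\<^sub>R 1"
    define E where "E = dx (Suc t) + dx t"
    have d: "norm d \<le> E" "norm d \<le> 2 * B" "0 \<le> E"
      using norm_x[of t] norm_x[of "Suc t"] norm_triangle_ineq4[of "x (Suc (Suc t))" "x (Suc t)"]
      by (auto simp: d_def dx_def E_def)
    have s: "0 \<le> s" "s \<le> 1" using sigma_bounds[of "Suc (Suc t)"] params by (auto simp: s_def)
    have xy: "norm (x (Suc (Suc t)) - y (Suc t)) \<le> E"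
      using norm_x_Suc_minus_y[of "Suc t"] by (simp add: E_def dx_def)
    have 1: "norm (gradient f (x (Suc (Suc t))) - gradient f (y (Suc t))) \<le> L * E"
      using f_lip[of "x (Suc (Suc t))" "y (Suc t)"] mult_left_mono[OF xy L_nonneg] by linarith
    have 2: "norm (v (Suc t) * (x (Suc (Suc t)) - y (Suc t))) \<le> V * E"
      using V xy by (intro order_trans[OF norm_mult_vec_le] mult_mono) auto
    have wd: "norm (w * d) \<le> V1 * E"
      unfolding w_def using V1 V1_nonneg d by (intro order_trans[OF norm_mult_vec_le] mult_mono) auto
    have 3: "norm (s *\<^sub>R (w * d)) \<le> V1 * E"
      using mult_left_le_one_le[OF norm_ge_zero s] wd s by (metis abs_of_nonneg norm_scaleR order_trans)
    have dd: "(norm d)\<^sup>2 \<le> 2 * B * E"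
      unfolding power2_eq_square using d B by (intro mult_mono) auto
    have 4: "norm (wnorm2 w d / 2) \<le> V1 * B * E"
    proof -
      have "\<bar>wnorm2 w d\<bar> \<le> V1 * (2 * B * E)"
        using V1_nonneg dd V1 unfolding w_def
        by (intro order_trans[OF wnorm2_le] mult_mono) auto
      then show ?thesis by simp
    qed
    have 5: "norm ((s / 2) *\<^sub>R (d * d)) \<le> B * E"
    proof -
      have "norm ((s / 2) *\<^sub>R (d * d)) \<le> 1 / 2 * (norm d)\<^sup>2"
        unfolding norm_scaleR power2_eq_square
        using s by (intro mult_mono norm_mult_vec_le) auto
      with dd show ?thesis by simp
    qed
    have "norm (subgrad (Suc t)) \<le>
        norm (gradient f (x (Suc (Suc t))) - gradient f (y (Suc t)) - v (Suc t) * (x (Suc (Suc t)) - y (Suc t)) + s *\<^sub>R (w * d))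
        + (norm (- (s *\<^sub>R (w * d))) + (norm (wnorm2 w d / 2) + norm ((s / 2) *\<^sub>R (d * d))))"
      unfolding subgrad_def Let_def d_def[symmetric] w_def[symmetric] s_def[symmetric]
      by (intro order_trans[OF norm_Pair_le_sum] add_left_mono order_refl)
    also have "\<dots> \<le> (L * E + V * E + V1 * E) + (V1 * E + (V1 * B * E + B * E))"
      using 1 2 3 4 5 unfolding norm_minus_cancel
      by (intro add_mono order_trans[OF norm_triangle_ineq]
          order_trans[OF norm_triangle_ineq4 add_mono])
    also have "\<dots> \<le> C * E" using d(3) by (simp add: C_def algebra_simps)
    finally show ?thesis by (simp add: E_def)
  qed
  moreover have "C > 0" unfolding C_def using L_nonneg V V1_nonneg B by (simp add: add_nonneg_pos)
  ultimately show ?thesis by blast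
qed

section \<open>Limit values and cluster points\<close>

lemma lyap_convergent: "\<exists>l. lyap \<longlonglongrightarrow> l \<and> eventually (\<lambda>t. l \<le> lyap t) sequentially"
proof -
  obtain T \<xi> where T: "T > 0" "\<xi> > 0"
    "\<And>t. t \<ge> T \<Longrightarrow> \<xi> * (norm (x (Suc t) - x t))\<^sup>2 \<le> lyap t - lyap (Suc t)"
    using sufficient_descent by blast
  have "lyap (Suc (t + T)) \<le> lyap (t + T)" for t
    using T(3)[of "t + T"] mult_nonneg_nonneg[OF less_imp_le[OF T(2)] zero_le_power2]
    by (metis diff_ge_0_iff_ge le_add2 order_trans)
  then have dec: "decseq (\<lambda>t. lyap (t + T))" by (intro decseq_SucI) simp
  have nonneg: "\<forall>t. 0 \<le> lyap (t + T)" using lyap_nonneg T(1) by simp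
  obtain l where l: "(\<lambda>t. lyap (t + T)) \<longlonglongrightarrow> l" "\<forall>t. l \<le> lyap (t + T)"
    by (rule decseq_convergent[OF dec nonneg])
  have "lyap \<longlonglongrightarrow> l" using l(1) by (rule LIMSEQ_offset)
  moreover have "eventually (\<lambda>t. l \<le> lyap t) sequentially"
  proof (rule eventually_sequentiallyI)
    show "l \<le> lyap t" if "T \<le> t" for t using l(2)[rule_format, of "t - T"] that by simp
  qed
  ultimately show ?thesis by blast
qed

definition linf where "linf = lim lyap"

lemma lyap_LIMSEQ: "lyap \<longlonglongrightarrow> linf"
  and linf_le: "eventually (\<lambda>t. linf \<le> lyap t) sequentially"
proof -
  obtain l where l: "lyap \<longlonglongrightarrow> l" "eventually (\<lambda>t. l \<le> lyap t) sequentially"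
    using lyap_convergent by blast
  from limI[OF l(1)] have "linf = l" by (simp add: linf_def)
  with l show "lyap \<longlonglongrightarrow> linf" "eventually (\<lambda>t. linf \<le> lyap t) sequentially" by auto
qed

lemma dx_LIMSEQ: "dx \<longlonglongrightarrow> 0"
  using tendsto_norm_zero[OF steps_tendsto_0] unfolding dx_def[abs_def] .

lemma back_diff_LIMSEQ: "(\<lambda>t. x t - x (t - 1)) \<longlonglongrightarrow> 0"
proof -
  have "(\<lambda>t. x (Suc t) - x (Suc t - 1)) \<longlonglongrightarrow> 0"
    using steps_tendsto_0 unfolding diff_Suc_1 .
  then show ?thesis by (rule LIMSEQ_imp_Suc)
qed

lemma objective_LIMSEQ: "(\<lambda>t. f (x t) + H (x t)) \<longlonglongrightarrow> linf + (f xbar + H xbar)"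
proof -
  have "(\<lambda>t. wnorm2 (\<sigma> t *\<^sub>R (v t + L *\<^sub>R 1)) (x t - x (t - 1))) \<longlonglongrightarrow> 0"
    by (intro wnorm2_tendsto_0[where ?w0.0 = "(\<theta> / (1 + \<theta>)) *\<^sub>R (vinf + L *\<^sub>R 1)"] back_diff_LIMSEQ tendsto_intros v_LIMSEQ sigma_LIMSEQ)
  then have "(\<lambda>t. lyap t + (f xbar + H xbar) - wnorm2 (\<sigma> t *\<^sub>R (v t + L *\<^sub>R 1)) (x t - x (t - 1)) / 2)
      \<longlonglongrightarrow> linf + (f xbar + H xbar) - 0 / 2"
    by (intro tendsto_intros lyap_LIMSEQ) auto
  then show ?thesis by (simp add: lyap_def)
qed

text \<open>The limit forced on \<open>W\<close> along any subsequence with x tending to z: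
  successive iterates merge, while \<open>\<sigma>\<close> and \<open>v\<close> converge.\<close>

definition Wlim where "Wlim z = (z, z, \<theta> / (1 + \<theta>), vinf)"

lemma W_LIMSEQ:
  assumes r: "filterlim r at_top sequentially" and z: "(\<lambda>n. x (r n)) \<longlonglongrightarrow> z"
  shows "(\<lambda>n. W (r n)) \<longlonglongrightarrow> Wlim z"
proof -
  have "(\<lambda>n. x (r n) - (x (r n) - x (r n - 1))) \<longlonglongrightarrow> z - 0"
    by (intro tendsto_intros z filterlim_compose[OF back_diff_LIMSEQ r])
  then show ?thesis
    unfolding AEPG_W_def Wlim_def
    by (intro tendsto_Pair z filterlim_compose[OF sigma_LIMSEQ r] filterlim_compose[OF v_LIMSEQ r]) simp
qed

lemma f_continuous: "isCont f z" and gradient_continuous: "isCont (gradient f) z"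
proof -
  show "isCont f z" using f_grad[of z] has_derivative_continuous unfolding gderiv_def by blast
  have "L-lipschitz_on UNIV (gradient f)"
    using f_lip L_nonneg by (intro lipschitz_onI) (auto simp: dist_norm)
  then show "isCont (gradient f) z"
    by (meson lipschitz_on_continuous_on continuous_on_eq_continuous_at open_UNIV UNIV_I)
qed

text \<open>As \<open>h\<close> is only lower semicontinuous, the value needs two inequalities:
  semicontinuity bounds h(z) by the limit of the values, and testing proximal minimality against z
  gives the converse.\<close>

lemma cluster_point_value:
  assumes r: "filterlim r at_top sequentially" and z: "(\<lambda>n. x (r n)) \<longlonglongrightarrow> z"
  shows "h z < \<infinity>" "Z (Wlim z) = ereal linf"
proof -
  define hz where "hz = linf + (f xbar + H xbar) - f z"
  have Hlim: "(\<lambda>n. H (x (r n))) \<longlonglongrightarrow> hz"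
  proof -
    have "(\<lambda>n. (f (x (r n)) + H (x (r n))) - f (x (r n))) \<longlonglongrightarrow> hz"
      unfolding hz_def
      by (intro tendsto_diff filterlim_compose[OF objective_LIMSEQ r] isCont_tendsto_compose[OF f_continuous] z)
    then show ?thesis by simp
  qed
  have pos: "eventually (\<lambda>n. 0 < r n) sequentially"
    using eventually_gt_at_top r by (rule eventually_compose_filterlim)
  have h_le: "h z \<le> ereal hz"
  proof (rule ccontr)
    assume "\<not> h z \<le> ereal hz"
    then obtain c where c: "ereal hz < ereal c" "ereal c < h z"
      using ereal_dense2[of "ereal hz" "h z"] by (auto simp: not_le)
    have "eventually (\<lambda>n. ereal c < h (x (r n))) sequentially"
      using lsc_fun_eventually_less[OF h_lsc z] c by simp
    moreover have "eventually (\<lambda>n. H (x (r n)) < c) sequentially"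
      using order_tendstoD(2)[OF Hlim] c by simp
    ultimately have "eventually (\<lambda>n. False) sequentially"
      using pos by eventually_elim (auto simp: h_x)
    then show False by simp
  qed
  then show fin: "h z < \<infinity>" by auto
  \<comment> \<open>The proximal step that produces \<open>x (r n)\<close> has index
    \<open>r n - 1\<close>; truncation at 0 does not occur for large n.\<close>
  define r' where "r' n = r n - 1" for n
  have r': "filterlim r' at_top sequentially"
    unfolding r'_def using r by (rule filterlim_compose[OF filterlim_minus_const_nat_at_top])
  have Suc_r': "eventually (\<lambda>n. Suc (r' n) = r n) sequentially"
    using pos by eventually_elim (auto simp: r'_def)
  have "(\<lambda>t. (x (Suc t) - x t) - \<sigma> t *\<^sub>R (x t - x (t - 1))) \<longlonglongrightarrow> 0 - (\<theta> / (1 + \<theta>)) *\<^sub>R 0"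
    by (intro tendsto_intros steps_tendsto_0 back_diff_LIMSEQ sigma_LIMSEQ)
  then have "(\<lambda>t. x (Suc t) - y t) \<longlonglongrightarrow> 0" by (simp add: x_Suc_minus_y)
  then have xy: "(\<lambda>n. x (Suc (r' n)) - y (r' n)) \<longlonglongrightarrow> 0" using r' by (rule filterlim_compose)
  have xr: "(\<lambda>n. x (Suc (r' n))) \<longlonglongrightarrow> z"
    by (rule Lim_transform_eventually[OF z]) (use Suc_r' in eventually_elim, simp)
  from tendsto_diff[OF xr xy] have yr: "(\<lambda>n. y (r' n)) \<longlonglongrightarrow> z" by simp
  then have "(\<lambda>n. z - y (r' n)) \<longlonglongrightarrow> z - z" by (intro tendsto_intros)
  then have zy: "(\<lambda>n. z - y (r' n)) \<longlonglongrightarrow> 0" by simp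
  have g: "(\<lambda>n. gradient f (y (r' n))) \<longlonglongrightarrow> gradient f z"
    using gradient_continuous yr by (rule isCont_tendsto_compose)
  have vr: "(\<lambda>n. v (r' n)) \<longlonglongrightarrow> vinf" using v_LIMSEQ r' by (rule filterlim_compose)
  have Hr: "(\<lambda>n. H (x (Suc (r' n)))) \<longlonglongrightarrow> hz"
    by (rule Lim_transform_eventually[OF Hlim]) (use Suc_r' in eventually_elim, simp)
  \<comment> \<open>Used for both sides of the minimality inequality: the new iterate and z each
    approach \<open>y\<close>, so both models vanish in the limit.\<close>
  have q0: "(\<lambda>n. gradient f (y (r' n)) \<bullet> a n + wnorm2 (v (r' n)) (a n) / 2) \<longlonglongrightarrow> 0"
    if "a \<longlonglongrightarrow> 0" for a
  proof -
    have "(\<lambda>n. gradient f (y (r' n)) \<bullet> a n + wnorm2 (v (r' n)) (a n) / 2) \<longlonglongrightarrow> gradient f z \<bullet> 0 + 0 / 2"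
      by (intro tendsto_intros g that wnorm2_tendsto_0[OF vr]) auto
    then show ?thesis by simp
  qed
  have "hz + 0 \<le> H z + 0"
  proof (rule LIMSEQ_le)
    show "(\<lambda>n. H (x (Suc (r' n))) + (gradient f (y (r' n)) \<bullet> (x (Suc (r' n)) - y (r' n))
        + wnorm2 (v (r' n)) (x (Suc (r' n)) - y (r' n)) / 2)) \<longlonglongrightarrow> hz + 0"
      by (intro tendsto_add Hr q0 xy)
    show "(\<lambda>n. H z + (gradient f (y (r' n)) \<bullet> (z - y (r' n))
        + wnorm2 (v (r' n)) (z - y (r' n)) / 2)) \<longlonglongrightarrow> H z + 0"
      by (intro tendsto_add tendsto_const q0 zy)
    show "\<exists>N. \<forall>n\<ge>N. H (x (Suc (r' n))) + (gradient f (y (r' n)) \<bullet> (x (Suc (r' n)) - y (r' n))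
        + wnorm2 (v (r' n)) (x (Suc (r' n)) - y (r' n)) / 2)
      \<le> H z + (gradient f (y (r' n)) \<bullet> (z - y (r' n)) + wnorm2 (v (r' n)) (z - y (r' n)) / 2)"
      using prox_ineq[of _ z] by (simp add: h_x h_eq_H[OF fin])
  qed
  moreover have "H z \<le> hz" using h_le by (simp add: h_eq_H[OF fin])
  ultimately have "H z = hz" by simp
  then show "Z (Wlim z) = ereal linf"
    by (simp add: Wlim_def Z_eq[OF fin] hz_def wnorm2_def)
qed

lemma cluster_point_critical:
  assumes r: "filterlim r at_top sequentially" and z: "(\<lambda>n. x (r n)) \<longlonglongrightarrow> z"
  shows "0 \<in> limiting_subdiff Z (Wlim z)"
proof -
  obtain C where C: "C > 0" "\<And>t. norm (subgrad (Suc t)) \<le> C * (dx (Suc t) + dx t)"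
    using subgrad_bound by blast
  have "(\<lambda>t. C * (dx (Suc t) + dx t)) \<longlonglongrightarrow> C * (0 + 0)"
    by (intro tendsto_intros dx_LIMSEQ LIMSEQ_Suc)
  then have lim: "(\<lambda>t. C * (dx (Suc t) + dx t)) \<longlonglongrightarrow> 0" by simp
  have "(\<lambda>t. subgrad (Suc t)) \<longlonglongrightarrow> 0"
    by (rule Lim_null_comparison[OF _ lim]) (simp add: C(2))
  then have sub: "subgrad \<longlonglongrightarrow> 0" by (rule LIMSEQ_imp_Suc)
  have "eventually (\<lambda>n. 0 < r n) sequentially"
    using eventually_gt_at_top r by (rule eventually_compose_filterlim)
  then obtain n0 where n0: "\<And>n. n \<ge> n0 \<Longrightarrow> 0 < r n" by (auto simp: eventually_sequentially)
  \<comment> \<open>The limiting subdifferential asks for subgradients at every index, so the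
    initial segment where \<open>r n\<close> may be 0 is cut off.\<close>
  define r' where "r' n = r (n + n0) - 1" for n
  have Suc_r': "Suc (r' n) = r (n + n0)" for n using n0[of "n + n0"] by (simp add: r'_def)
  have r': "filterlim (\<lambda>n. Suc (r' n)) at_top sequentially"
    unfolding Suc_r' using r by (rule filterlim_compose) (simp add: filterlim_add_const_nat_at_top)
  have xr: "(\<lambda>n. x (Suc (r' n))) \<longlonglongrightarrow> z"
    unfolding Suc_r' using z by (rule LIMSEQ_ignore_initial_segment)
  have "filterlim r' at_top sequentially"
    using r' by (simp add: filterlim_sequentially_Suc filterlim_at_top eventually_sequentially) (metis Suc_le_mono)
  then have "(\<lambda>n. subgrad (r' n)) \<longlonglongrightarrow> 0" by (rule filterlim_compose[OF sub])
  moreover have "(\<lambda>n. Z (W (Suc (r' n)))) \<longlonglongrightarrow> Z (Wlim z)"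
    using filterlim_compose[OF lyap_LIMSEQ r'] by (simp add: Z_W cluster_point_value[OF r z])
  ultimately have body: "(\<lambda>n. W (Suc (r' n))) \<longlonglongrightarrow> Wlim z \<and> (\<lambda>n. Z (W (Suc (r' n)))) \<longlonglongrightarrow> Z (Wlim z) \<and>
      (\<forall>n. subgrad (r' n) \<in> frechet_subdiff Z (W (Suc (r' n)))) \<and> (\<lambda>n. subgrad (r' n)) \<longlonglongrightarrow> 0"
    using W_LIMSEQ[OF r' xr] subgrad_frechet by blast
  have "\<exists>X U. X \<longlonglongrightarrow> Wlim z \<and> (\<lambda>k. Z (X k)) \<longlonglongrightarrow> Z (Wlim z) \<and>
      (\<forall>k. U k \<in> frechet_subdiff Z (X k)) \<and> U \<longlonglongrightarrow> 0"
    by (rule exI, rule exI, rule body)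
  then show ?thesis
    by (simp add: limiting_subdiff_def cluster_point_value[OF r z])
qed

section \<open>The KL inequality along the iterates\<close>

text \<open>The index map is arbitrary because the bound serves twice: along a subsequence before
  convergence is known, and along the whole sequence afterwards.\<close>

lemma KL_along_iterates:
  assumes r: "filterlim r at_top sequentially" and z: "(\<lambda>n. x (r n)) \<longlonglongrightarrow> z"
    and KL: "KL_property_at Z (Wlim z) p" "0 \<le> p" "p < 1"
  shows "\<exists>K>0. eventually (\<lambda>n. (lyap (r n) - linf) powr p \<le> K * (dx (r n - 1) + dx (r n - 2))) sequentially"
proof -
  obtain C where C: "C > 0" "\<And>t. norm (subgrad (Suc t)) \<le> C * (dx (Suc t) + dx t)"
    using subgrad_bound by blast
  from KL_real_inequality[OF KL cluster_point_value(2)[OF r z] C(1)]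
  obtain \<eta> K U where *: "\<eta> > 0" "K > 0" "open U" "Wlim z \<in> U"
    and kl: "\<forall>w'\<in>U. \<forall>z u E. Z w' = ereal z \<and> linf < z \<and> z < linf + \<eta> \<and>
      u \<in> frechet_subdiff Z w' \<and> norm u \<le> C * E \<longrightarrow> (z - linf) powr p \<le> K * E"
    by blast
  have "eventually (\<lambda>n. W (r n) \<in> U) sequentially"
    using W_LIMSEQ[OF r z] * by (intro topological_tendstoD)
  moreover have "eventually (\<lambda>n. lyap (r n) < linf + \<eta>) sequentially"
    using filterlim_compose[OF lyap_LIMSEQ r] * by (intro order_tendstoD(2)) auto
  moreover have "eventually (\<lambda>n. linf \<le> lyap (r n)) sequentially"
    using linf_le r by (rule eventually_compose_filterlim)
  moreover have "eventually (\<lambda>n. 1 < r n) sequentially"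
    using eventually_gt_at_top r by (rule eventually_compose_filterlim)
  ultimately have "eventually (\<lambda>n. (lyap (r n) - linf) powr p \<le> K * (dx (r n - 1) + dx (r n - 2))) sequentially"
  proof eventually_elim
    case (elim n)
    define t where "t = r n - 2"
    have t: "r n = Suc (Suc t)" using elim by (simp add: t_def)
    show ?case
    proof (cases "lyap (r n) = linf")
      case True
      \<comment> \<open>The KL property says nothing at gap 0, but there the left side is 0 even for
        p = 0, as \<open>0 powr 0 = 0\<close>.\<close>
      then show ?thesis using *(2) by (simp add: dx_def)
    next
      case False
      with elim have "linf < lyap (r n)" by simp
      then have "(lyap (r n) - linf) powr p \<le> K * (dx (Suc t) + dx t)"
        using kl[rule_format, of "W (r n)" "lyap (r n)" "subgrad (Suc t)"] elim subgrad_frechet[of "Suc t"] C(2)[of t] t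
        by (simp add: Z_W)
      then show ?thesis by (simp add: t)
    qed
  qed
  with *(2) show ?thesis by blast
qed

text \<open>The exponent may depend on the cluster point.  If no exponent and constant worked uniformly,
  then the inequality would fail for exponents tending to \<open>1\<close> and constants tending to \<open>\<infinity>\<close> along a
  subsequence, contradicting the KL property at a cluster point of that subsequence.\<close>

lemma KL_uniform:
  assumes "KL_function Z"
  shows "\<exists>p K. 0 \<le> p \<and> p < 1 \<and> 0 < K \<and>
    eventually (\<lambda>t. (lyap t - linf) powr p \<le> K * (dx (t - 1) + dx (t - 2))) sequentially"
proof (rule ccontr)
  assume contra: "\<not> ?thesis"
  \<comment> \<open>These exponents increase to 1 and so eventually exceed any exponent the KL
    property provides.\<close>
  define P where "P n = 1 - 1 / (real n + 1)" for n
  have P: "0 \<le> P n" "P n < 1" for n by (auto simp: P_def divide_le_eq)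
  have "\<exists>t\<ge>n. \<not> (lyap t - linf) powr P n \<le> (real n + 1) * (dx (t - 1) + dx (t - 2))" for n
  proof (rule ccontr)
    assume "\<not> ?thesis"
    then have "eventually (\<lambda>t. (lyap t - linf) powr P n \<le> (real n + 1) * (dx (t - 1) + dx (t - 2))) sequentially"
      by (auto simp: eventually_sequentially)
    moreover have "0 < real n + 1" by simp
    ultimately show False using contra P by blast
  qed
  then obtain r where r: "\<And>n. n \<le> r n"
    and fail: "\<And>n. \<not> (lyap (r n) - linf) powr P n \<le> (real n + 1) * (dx (r n - 1) + dx (r n - 2))"
    by metis
  \<comment> \<open>Writing \<open>Suc (r n - 1)\<close> avoids \<open>x 0\<close>, which need not
    lie in the bounded domain.\<close>
  have "bounded (range (\<lambda>n. x (Suc (r n - 1))))"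
    using norm_x by (intro boundedI) auto
  from bounded_imp_convergent_subsequence[OF this]
  obtain z s where s: "strict_mono s" and "((\<lambda>n. x (Suc (r n - 1))) \<circ> s) \<longlonglongrightarrow> z"
    by blast
  then have lim: "(\<lambda>n. x (Suc (r (s n) - 1))) \<longlonglongrightarrow> z" by (simp add: o_def)
  have "n \<le> r (s n)" for n
    using seq_suble[OF s, of n] r[of "s n"] by (rule order_trans)
  then have rs: "filterlim (\<lambda>n. r (s n)) at_top sequentially"
    by (intro filterlim_at_top_mono[OF filterlim_ident] always_eventually) simp
  have pos: "eventually (\<lambda>n. 0 < r (s n)) sequentially"
    using eventually_gt_at_top rs by (rule eventually_compose_filterlim)
  have z: "(\<lambda>n. x (r (s n))) \<longlonglongrightarrow> z"
    by (rule Lim_transform_eventually[OF lim]) (use pos in eventually_elim, simp)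
  obtain p where p: "0 \<le> p" "p < 1" "KL_property_at Z (Wlim z) p"
    using assms cluster_point_critical[OF rs z] unfolding KL_function_def by blast
  obtain K where K: "K > 0"
    "eventually (\<lambda>n. (lyap (r (s n)) - linf) powr p \<le> K * (dx (r (s n) - 1) + dx (r (s n) - 2))) sequentially"
    using KL_along_iterates[OF rs z p(3,1,2)] by blast
  have sn: "filterlim (\<lambda>n. real (s n)) at_top sequentially"
    using filterlim_compose[OF filterlim_real_sequentially filterlim_subseq[OF s]] .
  have "eventually (\<lambda>n. real (s n) > max K (1 / (1 - p))) sequentially"
    using sn unfolding filterlim_at_top_dense by blast
  moreover have "eventually (\<lambda>n. lyap (r (s n)) < linf + 1) sequentially"
    using filterlim_compose[OF lyap_LIMSEQ rs] by (intro order_tendstoD(2)) auto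
  moreover have "eventually (\<lambda>n. linf \<le> lyap (r (s n))) sequentially"
    using linf_le rs by (rule eventually_compose_filterlim)
  ultimately have "eventually (\<lambda>n. False) sequentially"
    using K(2)
  proof eventually_elim
    case (elim n)
    let ?D = "lyap (r (s n)) - linf" and ?E = "dx (r (s n) - 1) + dx (r (s n) - 2)"
    have E: "0 \<le> ?E" by (simp add: dx_def)
    have "p \<le> P (s n)"
    proof -
      have "1 / (real (s n) + 1) \<le> 1 / (1 / (1 - p))"
        using elim(1) p by (intro divide_left_mono) (auto simp: max_def split: if_splits)
      then show ?thesis by (simp add: P_def)
    qed
    \<comment> \<open>The gap is below 1, so a larger exponent gives a smaller power.\<close>
    then have "?D powr P (s n) \<le> ?D powr p"
      using elim by (cases "?D = 0") (auto intro!: powr_mono')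
    also have "\<dots> \<le> K * ?E" using elim by simp
    also have "\<dots> \<le> (real (s n) + 1) * ?E" using elim E by (intro mult_right_mono) auto
    finally show False using fail[of "s n"] by simp
  qed
  then show False by simp
qed

section \<open>Finite length, convergence and rates\<close>

text \<open>Starts beyond all thresholds; the extra 2 in \<open>lyap\<close> pairs each gap with the
  two steps before it, as the abstract lemmas expect.\<close>

lemma shifted_sequences:
  assumes "eventually (\<lambda>t. (lyap t - linf) powr p \<le> K * (dx (t - 1) + dx (t - 2))) sequentially"
  obtains T \<xi> where "0 < \<xi>"
    "\<And>k. 0 \<le> lyap (k + T + 2) - linf"
    "\<And>k. \<xi> * (dx (k + 2 + T))\<^sup>2 \<le> (lyap (k + T + 2) - linf) - (lyap (Suc k + T + 2) - linf)"
    "\<And>k. (lyap (k + T + 2) - linf) powr p \<le> K * (dx (k + T) + dx (Suc k + T))"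
proof -
  obtain T0 \<xi> where T0: "\<xi> > 0"
    "\<And>t. t \<ge> T0 \<Longrightarrow> \<xi> * (norm (x (Suc t) - x t))\<^sup>2 \<le> lyap t - lyap (Suc t)"
    using sufficient_descent by blast
  obtain T1 where T1: "\<And>t. t \<ge> T1 \<Longrightarrow> (lyap t - linf) powr p \<le> K * (dx (t - 1) + dx (t - 2))"
    using assms by (auto simp: eventually_sequentially)
  obtain T2 where T2: "\<And>t. t \<ge> T2 \<Longrightarrow> linf \<le> lyap t"
    using linf_le by (auto simp: eventually_sequentially)
  define T where "T = T0 + T1 + T2"
  show ?thesis
  proof (rule that[of \<xi> T])
    fix k
    show "0 \<le> lyap (k + T + 2) - linf" using T2[of "k + T + 2"] by (simp add: T_def)
    show "\<xi> * (dx (k + 2 + T))\<^sup>2 \<le> (lyap (k + T + 2) - linf) - (lyap (Suc k + T + 2) - linf)"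
      using T0(2)[of "k + 2 + T"] by (simp add: T_def dx_def add_ac)
    show "(lyap (k + T + 2) - linf) powr p \<le> K * (dx (k + T) + dx (Suc k + T))"
      using T1[of "k + T + 2"] by (simp add: T_def add_ac)
  qed (rule T0(1))
qed

lemma dx_nonneg: "0 \<le> dx t" by (simp add: dx_def)

lemma finite_length:
  assumes "KL_function Z"
  shows "summable dx"
proof -
  obtain p K where pK: "0 \<le> p" "p < 1" "0 < K"
    "eventually (\<lambda>t. (lyap t - linf) powr p \<le> K * (dx (t - 1) + dx (t - 2))) sequentially"
    using KL_uniform[OF assms] by blast
  obtain T \<xi> where "0 < \<xi>"
    "\<And>k. 0 \<le> lyap (k + T + 2) - linf"
    "\<And>k. \<xi> * (dx (k + 2 + T))\<^sup>2 \<le> (lyap (k + T + 2) - linf) - (lyap (Suc k + T + 2) - linf)"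
    "\<And>k. (lyap (k + T + 2) - linf) powr p \<le> K * (dx (k + T) + dx (Suc k + T))"
    by (rule shifted_sequences[OF pK(4)]) (rule that)
  then have "summable (\<lambda>k. dx (k + T))"
    using kl_descent_finite_length(1)[of "\<lambda>k. dx (k + T)" "\<lambda>k. lyap (k + T + 2) - linf" \<xi> K p]
      dx_nonneg pK by simp
  then show ?thesis by (simp add: summable_iff_shift)
qed

lemma convergence:
  assumes "KL_function Z"
  shows "\<exists>z. x \<longlonglongrightarrow> z \<and> W \<longlonglongrightarrow> Wlim z \<and> (\<exists>p. 0 \<le> p \<and> p < 1 \<and> KL_property_at Z (Wlim z) p)"
proof -
  have "summable (\<lambda>t. norm (x (Suc t) - x t))"
    using finite_length[OF assms] by (simp add: dx_def[abs_def])
  then obtain z where z: "x \<longlonglongrightarrow> z"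
    using dist_limit_le_tail(1) unfolding convergent_def by blast
  moreover have "\<exists>p. 0 \<le> p \<and> p < 1 \<and> KL_property_at Z (Wlim z) p"
    using assms cluster_point_critical[OF filterlim_ident z] unfolding KL_function_def by blast
  ultimately show ?thesis using W_LIMSEQ[OF filterlim_ident z] by blast
qed

text \<open>The exponent \<open>p\<close> at the limit may differ from the one used for finite
  length, so the KL inequality is derived anew along the whole sequence.\<close>

lemma rates:
  assumes "KL_function Z" "x \<longlonglongrightarrow> z" "KL_property_at Z (Wlim z) p" "0 \<le> p" "p < 1"
  shows "\<exists>t'.
     (p = 0 \<longrightarrow> (\<forall>t\<ge>t'. x t = z)) \<and>
     (0 < p \<and> p \<le> 1/2 \<longrightarrow>
       (\<exists>\<rho>. 0 < \<rho> \<and> \<rho> < 1 \<and> (\<exists>C>0. \<forall>t\<ge>t'. norm (x t - z) \<le> C * \<rho> ^ t))) \<and>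
     (1/2 < p \<and> p < 1 \<longrightarrow>
       (1 - p) / (2 * p - 1) > 0 \<and>
       (\<exists>C>0. \<forall>t\<ge>t'. norm (x t - z) \<le> C * real t powr (- ((1 - p) / (2 * p - 1)))))"
proof -
  obtain K where K: "0 < K"
    "eventually (\<lambda>t. (lyap t - linf) powr p \<le> K * (dx (t - 1) + dx (t - 2))) sequentially"
    using KL_along_iterates[OF filterlim_ident assms(2-5)] by blast
  obtain T \<xi> where T: "0 < \<xi>"
    "\<And>k. 0 \<le> lyap (k + T + 2) - linf"
    "\<And>k. \<xi> * (dx (k + 2 + T))\<^sup>2 \<le> (lyap (k + T + 2) - linf) - (lyap (Suc k + T + 2) - linf)"
    "\<And>k. (lyap (k + T + 2) - linf) powr p \<le> K * (dx (k + T) + dx (Suc k + T))"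
    by (rule shifted_sequences[OF K(2)]) (rule that)
  define R where "R t = (\<Sum>k. dx (k + t + T))" for t
  have R_alt: "R t = (\<Sum>k. dx (k + t + T))" for t by (rule R_def)
  note rates = kl_descent_rates[where e = "\<lambda>k. dx (k + T)" and D = "\<lambda>k. lyap (k + T + 2) - linf"
      and \<xi> = \<xi> and K = K and p = p and R = R, OF dx_nonneg T(2) T(1) K(1) assms(4,5) T(3) T(4) R_alt]
  have sm: "summable (\<lambda>t. norm (x (Suc t) - x t))"
    using finite_length[OF assms(1)] by (simp add: dx_def[abs_def])
  have le_R: "norm (x t - z) \<le> R (t - T)" if "t \<ge> T" for t
    using dist_limit_le_tail(2)[OF sm assms(2), of t] that by (simp add: R_def dx_def add.assoc)
  consider "p = 0" | "0 < p" "p \<le> 1/2" | "1/2 < p" using assms(4) by linarith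
  then show ?thesis
  proof cases
    case 1
    then obtain k where k: "\<And>t. t \<ge> k \<Longrightarrow> dx (t + T) = 0" using rates(1) by blast
    have "x t = z" if "t \<ge> k + T" for t
    proof -
      have "R (t - T) = (\<Sum>k. 0)"
        unfolding R_def using that by (intro suminf_cong k) simp
      with le_R[of t] that show ?thesis by simp
    qed
    with 1 show ?thesis by (intro exI[of _ "k + T"]) simp
  next
    case 2
    then obtain \<rho> C where \<rho>: "0 < \<rho>" "\<rho> < 1" "0 < C" "\<And>t. R t \<le> C * \<rho> ^ t" using rates(2) by blast
    \<comment> \<open>The index shift by \<open>T\<close> goes into the constant.\<close>
    have "norm (x t - z) \<le> C / \<rho> ^ T * \<rho> ^ t" if "t \<ge> T" for t
      using le_R[OF that] \<rho>(4)[of "t - T"] \<rho>(1) that by (simp add: power_diff)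
    moreover have "C / \<rho> ^ T > 0" using \<rho> by simp
    ultimately have "\<exists>\<rho>. 0 < \<rho> \<and> \<rho> < 1 \<and> (\<exists>C>0. \<forall>t\<ge>T. norm (x t - z) \<le> C * \<rho> ^ t)"
      using \<rho>(1,2) by blast
    with 2 show ?thesis by (intro exI[of _ T]) simp
  next
    case 3
    define s where "s = (1 - p) / (2 * p - 1)"
    have s: "s > 0" unfolding s_def using 3 assms(5) by (intro divide_pos_pos) linarith+
    obtain C where C: "C > 0" "\<And>t. t \<ge> 1 \<Longrightarrow> R t \<le> C * real t powr (- s)"
      using rates(3)[OF 3] unfolding s_def by blast
    \<comment> \<open>From 2 T + 2 on, t - T is at least 1 and at least t/2, which costs the factor
      2^s.\<close>
    have "norm (x t - z) \<le> C * 2 powr s * real t powr (- s)" if "t \<ge> 2 * T + 2" for t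
    proof -
      have "norm (x t - z) \<le> C * real (t - T) powr (- s)"
        by (rule order_trans[OF le_R C(2)]) (use that in auto)
      also have "\<dots> \<le> C * (real t / 2) powr (- s)"
        using that s C(1) by (intro mult_left_mono powr_mono2') (auto simp: of_nat_diff)
      also have "(real t / 2) powr (- s) = 2 powr s * real t powr (- s)"
        by (simp add: powr_divide powr_minus_divide)
      finally show ?thesis by (simp add: mult.assoc)
    qed
    moreover have "C * 2 powr s > 0" using C by simp
    ultimately have "\<exists>C>0. \<forall>t\<ge>2 * T + 2. norm (x t - z) \<le> C * real t powr (- s)" by blast
    with 3 s show ?thesis unfolding s_def by (intro exI[of _ "2 * T + 2"]) simp
  qed
qed

end

section \<open>Convergence rates\<close>

text \<open>The rates are claimed for every exponent valid at the limit of \<open>W\<close>, and one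
  such exponent is shown to exist, so the quantification is not vacuous.\<close>

theorem theorem4p8:
  fixes N :: nat
    and fs :: "nat \<Rightarrow> real ^ 'n \<Rightarrow> real"
    and h :: "real ^ 'n \<Rightarrow> ereal"
    and L xbound v0 \<alpha> \<beta> \<theta> :: real
    and xbar :: "real ^ 'n"
    and x y v :: "nat \<Rightarrow> real ^ 'n"
    and \<sigma> :: "nat \<Rightarrow> real"
  defines "f \<equiv> finite_avg N fs"
    and "F \<equiv> (\<lambda>z. ereal (finite_avg N fs z) + h z)"
    and "\<kappa> \<equiv> 1 + sqrt (\<beta> / \<alpha>)"
  defines "c1 \<equiv> 1/2 * ((1 - \<theta>) / \<kappa>)\<^sup>2"
    and "c2 \<equiv> 3 * L / 2"
    and "Z \<equiv> KL_Z F xbar L"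
  assumes N_pos: "N \<ge> 1"
    and h_proper: "proper_fun h"
    and h_lsc: "lsc_fun h"
    and prox_ex: "\<And>a w. Prox h a w \<noteq> {}"
    and xbound_pos: "xbound > 0"
    and dom_bounded: "\<And>z. z \<in> edom F \<Longrightarrow> norm z \<le> xbound"
    and F_bdd_below: "(INF z. F z) > -\<infinity>"
    and smooth: "\<And>j. j \<in> {1..N} \<Longrightarrow> L_smooth L (fs j)"
    and xbar: "is_argmin F xbar"
    and params: "v0 > 0" "\<alpha> > 0" "\<beta> \<ge> 0" "0 \<le> \<theta>" "\<theta> < 1"
    and algorithm: "AEPG f h v0 \<alpha> \<beta> \<theta> x y v \<sigma>"
    and KL: "KL_function Z"
    and tstar: "\<exists>ts. c1 * vmin (v ts) - c2 > 0"
  shows "\<exists>Winf. AEPG_W x v \<sigma> \<longlonglongrightarrow> Winf \<and>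
           (\<exists>p. 0 \<le> p \<and> p < 1 \<and> KL_property_at Z Winf p) \<and>
           (\<forall>p. 0 \<le> p \<and> p < 1 \<and> KL_property_at Z Winf p \<longrightarrow>
             (\<exists>t'.
               (p = 0 \<longrightarrow> (\<forall>t\<ge>t'. x t = fst Winf)) \<and>
               (0 < p \<and> p \<le> 1/2 \<longrightarrow>
                 (\<exists>\<rho>. 0 < \<rho> \<and> \<rho> < 1 \<and>
                   (\<exists>C>0. \<forall>t\<ge>t'. norm (x t - fst Winf) \<le> C * \<rho> ^ t))) \<and>
               (1/2 < p \<and> p < 1 \<longrightarrow>
                 (1 - p) / (2 * p - 1) > 0 \<and>
                 (\<exists>C>0. \<forall>t\<ge>t'. norm (x t - fst Winf)
                    \<le> C * real t powr (- ((1 - p) / (2 * p - 1)))))))"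
proof -
  have not_MInf: "h z \<noteq> -\<infinity>" for z using h_proper by (simp add: proper_fun_def)
  have F_min: "F xbar \<le> F z" for z
    using xbar by (simp add: is_argmin_def is_arg_min_def not_less)
  have xbar_fin: "h xbar < \<infinity>"
  proof -
    obtain z where "h z < \<infinity>" using h_proper by (auto simp: proper_fun_def edom_def)
    with F_min[of z] show ?thesis
      by (cases "h z"; cases "h xbar") (auto simp: F_def)
  qed
  have dom: "norm z \<le> xbound" if "h z < \<infinity>" for z
    using that not_MInf[of z] by (intro dom_bounded) (cases "h z"; simp add: edom_def F_def)
  interpret aepg f h L xbound v0 \<alpha> \<beta> \<theta> xbar x y v \<sigma>
  proof
    show "GDERIV f z :> gradient f z" and "norm (gradient f z - gradient f z') \<le> L * norm (z - z')" for z z'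
      unfolding f_def using finite_avg_smooth[OF N_pos smooth] by auto
    show "ereal (f xbar) + h xbar \<le> ereal (f z) + h z" for z
      using F_min[of z] by (simp add: F_def f_def)
    show "\<exists>ts. 1/2 * ((1 - \<theta>) / (1 + sqrt (\<beta> / \<alpha>)))\<^sup>2 * vmin (v ts) - 3 * L / 2 > 0"
      using tstar by (simp add: c1_def c2_def \<kappa>_def)
  qed (use not_MInf h_lsc dom xbar_fin params algorithm in auto)
  \<comment> \<open>Identifies the function \<open>Z\<close> of the locale with the one in the
    statement.\<close>
  have F_eq: "obj = F" by (rule ext, simp only: obj_def) (simp only: F_def f_def)
  note KL' = KL[unfolded Z_def, folded F_eq]
  obtain z where z: "x \<longlonglongrightarrow> z" "AEPG_W x v \<sigma> \<longlonglongrightarrow> Wlim z"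
    "\<exists>p. 0 \<le> p \<and> p < 1 \<and> KL_property_at Z (Wlim z) p"
    using convergence[OF KL'] unfolding F_eq Z_def by blast
  have fst: "fst (Wlim z) = z" by (simp add: Wlim_def)
  show ?thesis
    by (rule exI[of _ "Wlim z"], intro conjI allI impI z(2,3), elim conjE, unfold fst)
       (rule rates[OF KL' z(1), unfolded F_eq, folded Z_def])
qed

end
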